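(* Let $q$ be a prime power and $0<a<1$. Choose a non-negative integer $n$ with probability $(1-a)a^n$, and then choose $g$ uniformly at random from the symplectic group $Sp(2n,q)$ acting naturally on $\mathbb{F}_q^{2n}$ (with $Sp(0,q)$ trivial). Then for every integer $k\ge0$, the probability that $g$ has either exactly $q^{2k}$ or exactly $q^{2k+1}$ fixed vectors equals $$w_{AC}(p^{-k};a/q;p)=\left(\tfrac{a}{q}p;p\right)_\infty\frac{p^{k^2}(a/q)^k}{(p;p)_k\left(\tfrac{a}{q}p;p\right)_k},\qquad p=1/q^2.$$
   Context: For complex $A$, $B$ and integer $m\ge0$, $(A;B)_m=(1-A)(1-AB)\cdots(1-AB^{m-1})$ (with $(A;B)_0=1$), and for $|B|<1$, $(A;B)_\infty=\prod_{r\ge0}(1-AB^r)$. In general $w_{AC}(p^{-k};b;p)=(bp;p)_\infty\frac{p^{k^2}b^k}{(p;p)_k(bp;p)_k}$ is the Al-Salam–Carlitz weight. *)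

theory Defs
  imports "HOL-Probability.Probability" "Jordan_Normal_Form.Matrix"
begin

definition qpoch :: "'a::comm_ring_1 \<Rightarrow> 'a \<Rightarrow> nat \<Rightarrow> 'a" where
  "qpoch A B m = (\<Prod>r<m. 1 - A * B ^ r)"

definition qpoch_inf :: "'a::real_normed_field \<Rightarrow> 'a \<Rightarrow> 'a" where
  "qpoch_inf A B = (\<Prod>r. 1 - A * B ^ r)"

(* The weight at the point p^(-k), parametrised by k. *)
definition w_AC :: "nat \<Rightarrow> real \<Rightarrow> real \<Rightarrow> real" where
  "w_AC k b p =
     qpoch_inf (b * p) p * (p ^ (k ^ 2) * b ^ k / (qpoch p p k * qpoch (b * p) p k))"

definition symplectic_form_mat :: "nat \<Rightarrow> 'a::field mat" where
  "symplectic_form_mat n = four_block_mat (0\<^sub>m n n) (1\<^sub>m n) (- 1\<^sub>m n) (0\<^sub>m n n)"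

(* The underlying set of Sp(2n,F): the matrices preserving the standard nondegenerate
   alternating form on F^(2n), acting on column vectors.  In characteristic 2 the condition
   is still preservation of this alternating bilinear form. *)
definition Sp :: "nat \<Rightarrow> 'a::field mat set" where
  "Sp n = {A \<in> carrier_mat (2 * n) (2 * n).
             transpose_mat A * symplectic_form_mat n * A = symplectic_form_mat n}"

definition fixed_vectors :: "'a::field mat \<Rightarrow> 'a vec set" where
  "fixed_vectors g = {v \<in> carrier_vec (dim_col g). g *\<^sub>v v = v}"

(* geometric_pmf (1 - a) gives n the probability (1 - a) * a ^ n. *)
definition random_symplectic :: "real \<Rightarrow> 'a::{finite,field} mat pmf" where
  "random_symplectic a =
     bind_pmf (geometric_pmf (1 - a)) (\<lambda>n. pmf_of_set (Sp n))"

lemma one_in_Sp: "1\<^sub>m (2 * n) \<in> Sp n"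
  by (auto simp: Sp_def symplectic_form_mat_def mult_2)

lemma finite_Sp: "finite (Sp n :: 'a::{finite,field} mat set)"
proof (rule finite_subset)
  let ?I = "{..<2 * n} \<times> {..<2 * n}"
  show "(Sp n :: 'a mat set) \<subseteq> (\<lambda>f. mat (2 * n) (2 * n) f) ` (?I \<rightarrow>\<^sub>E UNIV)"
  proof
    fix A :: "'a mat" assume "A \<in> Sp n"
    then have "A = mat (2 * n) (2 * n) (restrict (\<lambda>ij. A $$ ij) ?I)"
      by (auto simp: Sp_def intro!: eq_matI)
    then show "A \<in> (\<lambda>f. mat (2 * n) (2 * n) f) ` (?I \<rightarrow>\<^sub>E UNIV)"
      by auto
  qed
  show "finite ((\<lambda>f. mat (2 * n) (2 * n) f) ` (?I \<rightarrow>\<^sub>E (UNIV :: 'a set)))"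
    by (intro finite_imageI finite_PiE) auto
qed

end

theory Submission
  imports Defs "Jordan_Normal_Form.Determinant"
begin

text \<open>Let \<open>N\<close> be the number of fixed vectors of a random \<open>g\<close> in \<open>Sp(2n,q)\<close>. Since \<open>Sp(2n,q)\<close> is
  transitive on nonzero vectors, weighting by \<open>N - 1\<close> amounts to conditioning on \<open>g e = e\<close> for one
  fixed \<open>e\<close>. The stabiliser of \<open>e\<close> consists of triples \<open>(h, w, c)\<close> with \<open>h \<in> Sp(2n-2,q)\<close>,
  \<open>w \<in> F^(2n-2)\<close>, \<open>c \<in> F\<close>; if \<open>h\<close> has \<open>N'\<close> fixed vectors, then the triple has \<open>N'\<close> of them unless
  \<open>w \<in> Im(1 - h)\<close> (an event of probability \<open>1/N'\<close>), and in that case \<open>q^2 N'\<close> for one value of \<open>c\<close>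
  and \<open>q N'\<close> for the others. Mixing over \<open>n\<close> with geometric weights closes this recursion: the
  probabilities \<open>P(y)\<close> of \<open>N = q^y\<close> satisfy
  \<open>(q^y - 1)(q^y - a) P(y) = a (q P(y-2) + (q - 1) P(y-1))\<close>. From this
  \<open>P(2k+1) = a / (q^(2k+1) - a) P(2k)\<close> and \<open>P(2k+1) = (q^(2k+2) - 1) P(2k+2)\<close>, so the ratios of
  consecutive \<open>P(2k) + P(2k+1)\<close> are those of the Al-Salam-Carlitz weights. The normalising factor
  follows from the functional equation of the series of weights under \<open>b \<mapsto> b p\<close>, together with
  \<open>1 - a \<le> P(0) + P(1) \<le> 1\<close>.\<close>

section \<open>Linear maps, matrices and bilinear forms\<close>

text \<open>The standard form is given in block shape, in which passing from 2n+2 to 2n coordinates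
  is awkward. It is replaced by the congruent form \<open>hyp n\<close>, built one hyperbolic plane
  at a time; congruent forms have the same distribution of the number of fixed vectors. This change
  of form and the transitivity on nonzero vectors have one source: every nonzero vector starts a
  symplectic basis. Forms are alternating in the sense \<open>bil J x x = 0\<close>, so
  characteristic 2 is no exception. The recursion in y has second order, yet one starting relation
  suffices: at y = 1 the term P(y-2) is absent, and from then on each of the two first-order
  relations yields the other by cancelling one factor on the left. With b = a/q, multiplying b by p
  amounts to multiplying the mixing parameter a by p. So both series in the functional equation
  belong to actual mixtures: their convergence comes from probabilities summing to 1, and as a p^m
  tends to 0 the mixture concentrates on the trivial group, which determines the constant.\<close>

lemma carrier_vec_SucE:
  assumes "x \<in> carrier_vec (Suc n)"
  obtains a u where "x = vCons a u" "u \<in> carrier_vec n"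
  using assms by (cases x) auto

lemma smult_vCons [simp]: "k \<cdot>\<^sub>v vCons a u = vCons (k * a) (k \<cdot>\<^sub>v u)"
  by (auto simp: vec_eq_iff vec_index_vCons)

lemma add_vCons [simp]: "dim_vec u = dim_vec v \<Longrightarrow> vCons a u + vCons b v = vCons (a + b) (u + v)"
  by (auto simp: vec_eq_iff vec_index_vCons)

lemma zero_smult_vec: "v \<in> carrier_vec n \<Longrightarrow> (0::'a::comm_ring_1) \<cdot>\<^sub>v v = 0\<^sub>v n"
  by (intro eq_vecI) auto

lemma vCons_split:
  fixes u :: "'a::comm_ring_1 vec"
  assumes "u \<in> carrier_vec n"
  shows "vCons a u = a \<cdot>\<^sub>v vCons 1 (0\<^sub>v n) + vCons 0 u"
  using assms by auto

lemma mult_vCons_row: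
  fixes u :: "'a::comm_ring_1 vec"
  assumes "A \<in> carrier_mat n m" "dim_vec c = n" "u \<in> carrier_vec m"
  shows "mat\<^sub>r n (Suc m) (\<lambda>i. vCons (c $ i) (row A i)) *\<^sub>v vCons a u = a \<cdot>\<^sub>v c + A *\<^sub>v u"
  using assms by (intro eq_vecI) (auto simp: mult.commute)

section \<open>Linear maps given as functions, and their matrices\<close>

definition lin :: "nat \<Rightarrow> nat \<Rightarrow> ('a::comm_ring_1 vec \<Rightarrow> 'a vec) \<Rightarrow> bool" where
  "lin m n f \<longleftrightarrow> (\<forall>x\<in>carrier_vec m. f x \<in> carrier_vec n) \<and>
     (\<forall>x\<in>carrier_vec m. \<forall>y\<in>carrier_vec m. f (x + y) = f x + f y) \<and>
     (\<forall>x\<in>carrier_vec m. \<forall>k. f (k \<cdot>\<^sub>v x) = k \<cdot>\<^sub>v f x)"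

text \<open>Induction on the source dimension splits off the first coordinate: the image of the
  first basis vector becomes a column put in front of the matrix for the remaining
  coordinates.\<close>

lemma lin_matrix_ex:
  assumes "lin m n f"
  shows "\<exists>A\<in>carrier_mat n m. \<forall>x\<in>carrier_vec m. A *\<^sub>v x = f x"
  using assms
proof (induction m arbitrary: f)
  case 0
  have z: "0 \<cdot>\<^sub>v vNil = (vNil :: 'a vec)" by auto
  have "f vNil \<in> carrier_vec n" "f vNil = 0 \<cdot>\<^sub>v f vNil"
    using 0 z unfolding lin_def by (metis vec_carrier)+
  moreover from this(1) have "0 \<cdot>\<^sub>v f vNil = 0\<^sub>v n" by (intro eq_vecI) auto
  ultimately have f0: "f vNil = 0\<^sub>v n" by simp
  show ?case
  proof (intro bexI[of _ "0\<^sub>m n 0"] ballI)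
    fix x :: "'a vec" assume "x \<in> carrier_vec 0"
    then have "x = vNil" by auto
    then show "0\<^sub>m n 0 *\<^sub>v x = f x" using f0 by (auto intro!: eq_vecI)
  qed simp
next
  case (Suc m)
  let ?g = "\<lambda>u. f (vCons 0 u)" and ?c = "f (vCons 1 (0\<^sub>v m))"
  have fc: "\<And>x. x \<in> carrier_vec (Suc m) \<Longrightarrow> f x \<in> carrier_vec n"
   and fa: "\<And>x y. x \<in> carrier_vec (Suc m) \<Longrightarrow> y \<in> carrier_vec (Suc m) \<Longrightarrow> f (x + y) = f x + f y"
   and fs: "\<And>x k. x \<in> carrier_vec (Suc m) \<Longrightarrow> f (k \<cdot>\<^sub>v x) = k \<cdot>\<^sub>v f x"
    using Suc.prems by (auto simp: lin_def)
  have "lin m n ?g"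
    unfolding lin_def
  proof (intro conjI ballI allI)
    fix x y :: "'a vec" and k assume xy: "x \<in> carrier_vec m" "y \<in> carrier_vec m"
    show "?g (x + y) = ?g x + ?g y"
      using fa[of "vCons 0 x" "vCons 0 y"] xy by simp
  next
    fix x :: "'a vec" and k assume xy: "x \<in> carrier_vec m"
    show "?g (k \<cdot>\<^sub>v x) = k \<cdot>\<^sub>v ?g x"
      using fs[of "vCons 0 x" k] xy by simp
  qed (simp add: fc)
  then obtain A where A: "A \<in> carrier_mat n m" "\<forall>x\<in>carrier_vec m. A *\<^sub>v x = ?g x"
    using Suc.IH by blast
  have c: "?c \<in> carrier_vec n" by (simp add: fc)
  show ?case
  proof (intro bexI[of _ "mat\<^sub>r n (Suc m) (\<lambda>i. vCons (?c $ i) (row A i))"] ballI)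
    fix x :: "'a vec" assume "x \<in> carrier_vec (Suc m)"
    then obtain a u where x: "x = vCons a u" "u \<in> carrier_vec m" by (rule carrier_vec_SucE)
    have "f x = f (a \<cdot>\<^sub>v vCons 1 (0\<^sub>v m) + vCons 0 u)"
      using vCons_split[OF x(2), of a] x(1) by (rule_tac arg_cong) auto
    also have "\<dots> = a \<cdot>\<^sub>v ?c + ?g u"
      using x(2) by (subst fa) (simp_all only: fs smult_carrier_vec vCons_carrier_vec zero_carrier_vec)
    finally show "mat\<^sub>r n (Suc m) (\<lambda>i. vCons (?c $ i) (row A i)) *\<^sub>v x = f x"
      using mult_vCons_row[OF A(1) carrier_vecD[OF c] x(2)] A(2) x by simp
  qed simp
qed

lemma mult_mat_vec_unit:
  assumes "A \<in> carrier_mat n m" "j < m"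
  shows "A *\<^sub>v unit_vec m j = (col A j :: 'a::comm_ring_1 vec)"
  using assms by (intro eq_vecI) (auto simp: scalar_prod_def unit_vec_def if_distrib cong: if_cong)

lemma mat_eqI_mult_vec:
  fixes A B :: "'a::comm_ring_1 mat"
  assumes "A \<in> carrier_mat n m" "B \<in> carrier_mat n m"
    and "\<And>x. x \<in> carrier_vec m \<Longrightarrow> A *\<^sub>v x = B *\<^sub>v x"
  shows "A = B"
proof (rule mat_col_eqI)
  fix j assume "j < dim_col B"
  then show "col A j = col B j"
    using assms mult_mat_vec_unit[of A n m j] mult_mat_vec_unit[of B n m j] by simp
qed (use assms in auto)

text \<open>An explicit matrix instead of an existence statement, so that matrices depending on
  parameters, such as \<open>stab_mat\<close>, can be defined from functions.\<close>

definition mat_of :: "nat \<Rightarrow> nat \<Rightarrow> ('a::comm_ring_1 vec \<Rightarrow> 'a vec) \<Rightarrow> 'a mat" where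
  "mat_of n m f = mat n m (\<lambda>(i, j). f (unit_vec m j) $ i)"

lemma mat_of_carrier [simp]: "mat_of n m f \<in> carrier_mat n m"
  by (simp add: mat_of_def)

lemma mat_of_mult_vec:
  assumes "lin m n f" "x \<in> carrier_vec m"
  shows "mat_of n m f *\<^sub>v x = f x"
proof -
  obtain A where A: "A \<in> carrier_mat n m" "\<And>x. x \<in> carrier_vec m \<Longrightarrow> A *\<^sub>v x = f x"
    using lin_matrix_ex[OF assms(1)] by blast
  have "mat_of n m f = A"
  proof (rule eq_matI)
    fix i j assume ij: "i < dim_row A" "j < dim_col A"
    then have "f (unit_vec m j) $ i = col A j $ i"
      using A(1) A(2)[of "unit_vec m j"] mult_mat_vec_unit[OF A(1), of j] by simp
    then show "mat_of n m f $$ (i, j) = A $$ (i, j)" using ij A(1) by (simp add: mat_of_def)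
  qed (use A in \<open>auto simp: mat_of_def\<close>)
  then show ?thesis using A assms by simp
qed

lemma vec_eq_0I_scalar_prod:
  fixes x :: "'a::comm_ring_1 vec"
  assumes "x \<in> carrier_vec n" "\<And>y. y \<in> carrier_vec n \<Longrightarrow> y \<bullet> x = 0"
  shows "x = 0\<^sub>v n"
proof (rule eq_vecI)
  fix i assume "i < dim_vec (0\<^sub>v n :: 'a vec)"
  then show "x $ i = 0\<^sub>v n $ i" using assms(2)[of "unit_vec n i"] assms(1) by auto
qed (use assms in auto)

text \<open>A trivial kernel means a nonzero determinant, which over a field gives a two-sided
  inverse.\<close>

lemma injective_mat_inverse:
  fixes A :: "'a::field mat"
  assumes A: "A \<in> carrier_mat n n" and inj: "\<And>x. x \<in> carrier_vec n \<Longrightarrow> A *\<^sub>v x = 0\<^sub>v n \<Longrightarrow> x = 0\<^sub>v n"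
  obtains B where "B \<in> carrier_mat n n" "A * B = 1\<^sub>m n" "B * A = 1\<^sub>m n"
proof -
  have "det A \<noteq> 0" using inj det_0_iff_vec_prod_zero_field[OF A] by auto
  then have "A \<in> Units (ring_mat TYPE('a) n ())" by (rule det_non_zero_imp_unit[OF A])
  then show ?thesis using that by (auto simp: Units_def ring_mat_simps)
qed

lemma mult_mat_zero_vec [simp]: "A \<in> carrier_mat n m \<Longrightarrow> A *\<^sub>v 0\<^sub>v m = (0\<^sub>v n :: 'a::comm_ring_1 vec)"
  by (intro eq_vecI) auto

section \<open>Bilinear and alternating forms\<close>

definition bil :: "'a::comm_ring_1 mat \<Rightarrow> 'a vec \<Rightarrow> 'a vec \<Rightarrow> 'a" where
  "bil J x y = x \<bullet> (J *\<^sub>v y)"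

context
  fixes J :: "'a::field mat" and n
  assumes J: "J \<in> carrier_mat n n"
begin

lemma bil_add_left: "x \<in> carrier_vec n \<Longrightarrow> x' \<in> carrier_vec n \<Longrightarrow> y \<in> carrier_vec n \<Longrightarrow>
    bil J (x + x') y = bil J x y + bil J x' y"
  using J by (auto simp: bil_def intro!: add_scalar_prod_distrib)

lemma bil_add_right: "x \<in> carrier_vec n \<Longrightarrow> y \<in> carrier_vec n \<Longrightarrow> y' \<in> carrier_vec n \<Longrightarrow>
    bil J x (y + y') = bil J x y + bil J x y'"
  using J by (auto simp: bil_def mult_add_distrib_mat_vec[OF J] intro!: scalar_prod_add_distrib)

lemma bil_smult_left: "x \<in> carrier_vec n \<Longrightarrow> y \<in> carrier_vec n \<Longrightarrow> bil J (k \<cdot>\<^sub>v x) y = k * bil J x y"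
  using J by (auto simp: bil_def)

lemma bil_smult_right: "x \<in> carrier_vec n \<Longrightarrow> y \<in> carrier_vec n \<Longrightarrow> bil J x (k \<cdot>\<^sub>v y) = k * bil J x y"
  using J by (simp add: bil_def mult_mat_vec[OF J] scalar_prod_smult_distrib[of _ n])

lemma bil_zero_left: "y \<in> carrier_vec n \<Longrightarrow> bil J (0\<^sub>v n) y = 0"
  using J by (auto simp: bil_def)

lemma bil_zero_right: "x \<in> carrier_vec n \<Longrightarrow> bil J x (0\<^sub>v n) = 0"
  using J by (auto simp: bil_def)

lemma bil_congruence:
  assumes "A \<in> carrier_mat n m" "x \<in> carrier_vec m" "y \<in> carrier_vec m"
  shows "bil (transpose_mat A * J * A) x y = bil J (A *\<^sub>v x) (A *\<^sub>v y)"
  using J assms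
  by (simp add: bil_def assoc_mult_mat_vec[of _ m n _ m] assoc_mult_mat_vec[of _ m n _ n]
      comm_scalar_prod[of x m] comm_scalar_prod[of "A *\<^sub>v x" n] transpose_vec_mult_scalar[of A n m])

end

lemma mat_eqI_bil:
  fixes A B :: "'a::field mat"
  assumes "A \<in> carrier_mat n n" "B \<in> carrier_mat n n"
    and "\<And>x y. x \<in> carrier_vec n \<Longrightarrow> y \<in> carrier_vec n \<Longrightarrow> bil A x y = bil B x y"
  shows "A = B"
proof (rule eq_matI)
  fix i j assume "i < dim_row B" "j < dim_col B"
  then have ij: "i < n" "j < n" using assms by auto
  have "\<And>M. M \<in> carrier_mat n n \<Longrightarrow> bil M (unit_vec n i) (unit_vec n j) = M $$ (i, j)"
    unfolding bil_def using ij by (simp add: mult_mat_vec_unit)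
  then show "A $$ (i, j) = B $$ (i, j)" using assms by (metis unit_vec_carrier)
qed (use assms in auto)

text \<open>Alternation is demanded as \<open>bil J x x = 0\<close>, since skew symmetry is weaker
  in characteristic 2; nondegeneracy is the triviality of the kernel of J.\<close>

definition alt_form :: "nat \<Rightarrow> 'a::field mat \<Rightarrow> bool" where
  "alt_form n J \<longleftrightarrow> J \<in> carrier_mat n n \<and> (\<forall>x\<in>carrier_vec n. bil J x x = 0) \<and>
     (\<forall>x\<in>carrier_vec n. J *\<^sub>v x = 0\<^sub>v n \<longrightarrow> x = 0\<^sub>v n)"

context
  fixes J :: "'a::field mat" and n
  assumes alt: "alt_form n J"
begin

lemma alt_form_carrier: "J \<in> carrier_mat n n"
  using alt by (simp add: alt_form_def)

lemma bil_self: "x \<in> carrier_vec n \<Longrightarrow> bil J x x = 0"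
  using alt by (simp add: alt_form_def)

lemma bil_skew:
  assumes "x \<in> carrier_vec n" "y \<in> carrier_vec n"
  shows "bil J y x = - bil J x y"
  using bil_self[of "x + y"] bil_self[of x] bil_self[of y] assms
  by (simp add: bil_add_left[OF alt_form_carrier] bil_add_right[OF alt_form_carrier] eq_neg_iff_add_eq_0
      add.commute)

text \<open>By skew symmetry, a vector x orthogonal to everything has an image under J whose scalar
  product with every vector is zero, so x lies in the kernel.\<close>

lemma bil_nondegenerate:
  assumes "x \<in> carrier_vec n" "\<And>y. y \<in> carrier_vec n \<Longrightarrow> bil J x y = 0"
  shows "x = 0\<^sub>v n"
proof -
  have "J *\<^sub>v x = 0\<^sub>v n"
  proof (rule vec_eq_0I_scalar_prod)
    show "J *\<^sub>v x \<in> carrier_vec n" using alt_form_carrier assms by auto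
    show "y \<bullet> (J *\<^sub>v x) = 0" if "y \<in> carrier_vec n" for y
      using bil_skew[OF assms(1) that] assms(2)[OF that] by (simp add: bil_def)
  qed
  then show ?thesis using alt assms by (auto simp: alt_form_def)
qed

end

lemma alt_formI:
  fixes J :: "'a::field mat"
  assumes J: "J \<in> carrier_mat n n" and "\<And>x. x \<in> carrier_vec n \<Longrightarrow> bil J x x = 0"
    and nd: "\<And>y. y \<in> carrier_vec n \<Longrightarrow> (\<And>x. x \<in> carrier_vec n \<Longrightarrow> bil J x y = 0) \<Longrightarrow> y = 0\<^sub>v n"
  shows "alt_form n J"
  unfolding alt_form_def
proof (intro conjI ballI impI)
  fix y :: "'a vec" assume y: "y \<in> carrier_vec n" "J *\<^sub>v y = 0\<^sub>v n"
  show "y = 0\<^sub>v n" by (rule nd) (use y in \<open>auto simp: bil_def\<close>)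
qed (use assms in auto)

section \<open>Hyperbolic planes\<close>

definition injective_mat :: "nat \<Rightarrow> 'a::field mat \<Rightarrow> bool" where
  "injective_mat n A \<longleftrightarrow> A \<in> carrier_mat n n \<and> (\<forall>x\<in>carrier_vec n. A *\<^sub>v x = 0\<^sub>v n \<longrightarrow> x = 0\<^sub>v n)"

lemma injective_mat_carrier: "injective_mat n A \<Longrightarrow> A \<in> carrier_mat n n"
  by (simp add: injective_mat_def)

lemma injective_mat_one [simp]: "injective_mat n (1\<^sub>m n)"
  by (auto simp: injective_mat_def)

lemma injective_mat_mult:
  "injective_mat n A \<Longrightarrow> injective_mat n B \<Longrightarrow> injective_mat n (A * B)"
  by (auto simp: injective_mat_def assoc_mult_mat_vec[of _ n n _ n])

lemma injective_mat_obtain_inverse: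
  assumes "injective_mat n A"
  obtains B where "injective_mat n B" "A * B = 1\<^sub>m n" "B * A = 1\<^sub>m n"
proof -
  obtain B where B: "B \<in> carrier_mat n n" "A * B = 1\<^sub>m n" "B * A = 1\<^sub>m n"
    using assms injective_mat_inverse[of A n] unfolding injective_mat_def by blast
  have A: "A \<in> carrier_mat n n" using assms by (rule injective_mat_carrier)
  have "injective_mat n B"
    unfolding injective_mat_def
  proof (intro conjI ballI impI)
    fix x assume x: "x \<in> carrier_vec n" "B *\<^sub>v x = 0\<^sub>v n"
    have "x = (A * B) *\<^sub>v x" using x B by simp
    also have "\<dots> = A *\<^sub>v (B *\<^sub>v x)" using A B x by (intro assoc_mult_mat_vec)
    also have "\<dots> = 0\<^sub>v n" using x A by simp
    finally show "x = 0\<^sub>v n" .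
  qed (rule B)
  with that B show ?thesis by blast
qed

lemma nonzero_vec_componentE:
  fixes v :: "'a::field vec"
  assumes "v \<in> carrier_vec n" "v \<noteq> 0\<^sub>v n"
  obtains i where "i < n" "v $ i \<noteq> 0"
  using assms by (metis carrier_vecD eq_vecI index_zero_vec)

lemma complete_vector:
  fixes v :: "'a::field vec"
  assumes v: "v \<in> carrier_vec (Suc n)" "v \<noteq> 0\<^sub>v (Suc n)"
  shows "\<exists>P. injective_mat (Suc n) P \<and> P *\<^sub>v vCons 1 (0\<^sub>v n) = v"
proof -
  obtain i where i: "i < Suc n" "v $ i \<noteq> 0" by (rule nonzero_vec_componentE[OF v])
  let ?N = "Suc n"
  \<comment> \<open>\<open>s\<close> exchanges 0 and i. The columns of the matrix are v followed by
    all unit vectors except the i-th, the one that v replaces in the basis.\<close>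
  define s where "s r = (if r = 0 then i else if r = i then 0 else r)" for r :: nat
  have s: "s r < ?N" if "r < ?N" for r using that i by (auto simp: s_def)
  have ss: "s (s r) = r" for r by (auto simp: s_def)
  define f where "f x = vec ?N (\<lambda>r. v $ r * x $ 0 + (if r = i then 0 else x $ s r))" for x :: "'a vec"
  have "lin ?N ?N f"
    unfolding lin_def f_def by (auto intro!: eq_vecI simp: s algebra_simps)
  then obtain P where P: "P \<in> carrier_mat ?N ?N" "\<And>x. x \<in> carrier_vec ?N \<Longrightarrow> P *\<^sub>v x = f x"
    using lin_matrix_ex by blast
  have "P *\<^sub>v vCons 1 (0\<^sub>v n) = v"
  proof (rule eq_vecI)
    fix r assume "r < dim_vec v"
    then have r: "r < ?N" using v by auto
    have "s r = 0 \<longleftrightarrow> r = i" by (auto simp: s_def)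
    then show "(P *\<^sub>v vCons 1 (0\<^sub>v n)) $ r = v $ r"
      using r s[OF r] by (cases "s r") (auto simp: P f_def)
  qed (use P v in \<open>auto simp: f_def\<close>)
  moreover have "x = 0\<^sub>v ?N" if x: "x \<in> carrier_vec ?N" "P *\<^sub>v x = 0\<^sub>v ?N" for x
  proof -
    have e: "v $ r * x $ 0 + (if r = i then 0 else x $ s r) = 0" if "r < ?N" for r
      using arg_cong[OF x(2)[unfolded P(2)[OF x(1)]], of "\<lambda>y. y $ r"] that by (simp add: f_def)
    \<comment> \<open>Row i involves only the first coordinate, with the nonzero coefficient
      \<open>v $ i\<close>.\<close>
    have x0: "x $ 0 = 0" using e[OF i(1)] i(2) by simp
    show ?thesis
    proof (rule eq_vecI)
      fix j assume "j < dim_vec (0\<^sub>v ?N :: 'a vec)"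
      then have j: "j < ?N" by simp
      show "x $ j = 0\<^sub>v ?N $ j"
      proof (cases "j = 0")
        case False
        then have "s j \<noteq> i" by (auto simp: s_def split: if_splits)
        then show ?thesis using e[OF s[OF j]] j by (simp add: x0 ss)
      qed (simp add: x0)
    qed (use x in auto)
  qed
  ultimately show ?thesis using P(1) unfolding injective_mat_def by blast
qed

text \<open>\<open>complete_vector\<close> is applied twice, the second time to w modulo v in the
  coordinates of the first basis. The discarded multiple k of v is harmless later, because v is
  orthogonal to itself.\<close>

lemma complete_pair:
  fixes v w :: "'a::field vec"
  assumes v: "v \<in> carrier_vec (Suc (Suc n))" "v \<noteq> 0\<^sub>v (Suc (Suc n))"
    and w: "w \<in> carrier_vec (Suc (Suc n))" "\<And>k. w \<noteq> k \<cdot>\<^sub>v v"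
  shows "\<exists>P k. injective_mat (Suc (Suc n)) P \<and> P *\<^sub>v vCons 1 (0\<^sub>v (Suc n)) = v \<and>
           P *\<^sub>v vCons 0 (vCons 1 (0\<^sub>v n)) + k \<cdot>\<^sub>v v = w"
proof -
  let ?N = "Suc (Suc n)"
  obtain P where P: "injective_mat ?N P" "P *\<^sub>v vCons 1 (0\<^sub>v (Suc n)) = v"
    using complete_vector[OF v] by blast
  obtain Q where Q: "injective_mat ?N Q" "P * Q = 1\<^sub>m ?N" "Q * P = 1\<^sub>m ?N"
    using injective_mat_obtain_inverse[OF P(1)] .
  note PQ = injective_mat_carrier[OF P(1)] injective_mat_carrier[OF Q(1)]
  have "Q *\<^sub>v w \<in> carrier_vec ?N" using PQ w by auto
  then obtain k u where ku: "Q *\<^sub>v w = vCons k u" "u \<in> carrier_vec (Suc n)"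
    by (rule carrier_vec_SucE)
  have w_eq: "w = k \<cdot>\<^sub>v v + P *\<^sub>v vCons 0 u"
  proof -
    have "w = (P * Q) *\<^sub>v w" using Q w by simp
    also have "\<dots> = P *\<^sub>v vCons k u"
      using PQ w by (simp add: assoc_mult_mat_vec[of _ ?N ?N _ ?N] ku)
    also have "vCons k u = k \<cdot>\<^sub>v vCons 1 (0\<^sub>v (Suc n)) + vCons 0 u"
      by (rule vCons_split[OF ku(2)])
    also have "P *\<^sub>v \<dots> = k \<cdot>\<^sub>v v + P *\<^sub>v vCons 0 u"
      using PQ ku by (subst mult_add_distrib_mat_vec[OF PQ(1)])
        (simp_all only: mult_mat_vec[OF PQ(1)] smult_carrier_vec vCons_carrier_vec zero_carrier_vec P(2))
    finally show ?thesis .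
  qed
  have "u \<noteq> 0\<^sub>v (Suc n)"
  proof
    assume "u = 0\<^sub>v (Suc n)"
    then have "vCons 0 u = 0\<^sub>v ?N" by (simp add: zero_vec_Suc)
    then have "P *\<^sub>v vCons 0 u = 0\<^sub>v ?N" using PQ(1) by simp
    then show False using w_eq w(2)[of k] v by simp
  qed
  then obtain R where R: "injective_mat (Suc n) R" "R *\<^sub>v vCons 1 (0\<^sub>v n) = u"
    using complete_vector[OF ku(2)] by blast
  note Rc = injective_mat_carrier[OF R(1)]
  \<comment> \<open>The identity on the first coordinate and \<open>R\<close> on the others:
    composing \<open>P\<close> with it keeps the image v of the first unit vector and takes the
    second one to w minus its v-component.\<close>
  define f where "f x = vCons (x $ 0) (R *\<^sub>v vec (Suc n) (\<lambda>i. x $ Suc i))" for x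
  have tl: "vec (Suc n) (\<lambda>i. vCons a y $ Suc i) = y" if "y \<in> carrier_vec (Suc n)" for a :: 'a and y
    using that by (auto intro!: eq_vecI)
  have f: "f (vCons a y) = vCons a (R *\<^sub>v y)" if "y \<in> carrier_vec (Suc n)" for a y
    using that unfolding f_def by (simp only: tl vec_index_vCons_0)
  have "lin ?N ?N f"
    unfolding lin_def
  proof (intro conjI ballI allI)
    fix x y :: "'a vec" and k :: 'a assume "x \<in> carrier_vec ?N"
    then obtain a x' where x: "x = vCons a x'" "x' \<in> carrier_vec (Suc n)" by (rule carrier_vec_SucE)
    show "f x \<in> carrier_vec ?N" using x Rc by (simp add: f)
    show "f (k \<cdot>\<^sub>v x) = k \<cdot>\<^sub>v f x" using x by (simp add: f mult_mat_vec[OF Rc])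
    assume "y \<in> carrier_vec ?N"
    then obtain b y' where y: "y = vCons b y'" "y' \<in> carrier_vec (Suc n)" by (rule carrier_vec_SucE)
    show "f (x + y) = f x + f y" using x y Rc by (simp add: f mult_add_distrib_mat_vec[OF Rc])
  qed
  then obtain E where E: "E \<in> carrier_mat ?N ?N" "\<And>x. x \<in> carrier_vec ?N \<Longrightarrow> E *\<^sub>v x = f x"
    using lin_matrix_ex by blast
  have "injective_mat ?N E"
    unfolding injective_mat_def
  proof (intro conjI ballI impI)
    fix x :: "'a vec" assume x0: "x \<in> carrier_vec ?N" "E *\<^sub>v x = 0\<^sub>v ?N"
    then obtain a x' where x: "x = vCons a x'" "x' \<in> carrier_vec (Suc n)" by (metis carrier_vec_SucE)
    have "vCons a (R *\<^sub>v x') = vCons 0 (0\<^sub>v (Suc n))" using x x0 by (simp add: E f zero_vec_Suc)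
    then show "x = 0\<^sub>v ?N" using R(1) x by (simp add: injective_mat_def zero_vec_Suc)
  qed (rule E)
  then have "injective_mat ?N (P * E)" by (intro injective_mat_mult P)
  moreover have "(P * E) *\<^sub>v vCons 1 (0\<^sub>v (Suc n)) = v"
    using PQ E Rc by (simp add: assoc_mult_mat_vec[of _ ?N ?N _ ?N] f P)
  moreover have "(P * E) *\<^sub>v vCons 0 (vCons 1 (0\<^sub>v n)) + k \<cdot>\<^sub>v v = w"
    using PQ E Rc ku v
    by (simp add: assoc_mult_mat_vec[of _ ?N ?N _ ?N] f R w_eq comm_add_vec[of _ ?N])
  ultimately show ?thesis by blast
qed

text \<open>The orthogonal sum of a hyperbolic plane, on the first two coordinates, and \<open>J\<close>.\<close>

definition hplus :: "'a::field mat \<Rightarrow> 'a mat" where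
  "hplus J = (let n = dim_row J in mat\<^sub>r (Suc (Suc n)) (Suc (Suc n))
     (\<lambda>i. case i of 0 \<Rightarrow> vCons 0 (vCons 1 (0\<^sub>v n))
          | Suc j \<Rightarrow> (case j of 0 \<Rightarrow> vCons (-1) (vCons 0 (0\<^sub>v n))
          | Suc k \<Rightarrow> vCons 0 (vCons 0 (row J k)))))"

lemma hplus_carrier [simp]: "J \<in> carrier_mat n n \<Longrightarrow> hplus J \<in> carrier_mat (Suc (Suc n)) (Suc (Suc n))"
  by (auto simp: hplus_def Let_def)

lemma hplus_mult_vec:
  assumes "J \<in> carrier_mat n n" "u \<in> carrier_vec n"
  shows "hplus J *\<^sub>v vCons a (vCons b u) = vCons b (vCons (- a) (J *\<^sub>v u))"
proof (rule eq_vecI)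
  fix i assume "i < dim_vec (vCons b (vCons (- a) (J *\<^sub>v u)))"
  then have i: "i < Suc (Suc n)" using assms by auto
  then show "(hplus J *\<^sub>v vCons a (vCons b u)) $ i = vCons b (vCons (- a) (J *\<^sub>v u)) $ i"
    using assms by (auto simp: hplus_def Let_def vec_index_vCons split: nat.split)
qed (use assms in \<open>auto simp: hplus_def Let_def\<close>)

lemma bil_hplus:
  assumes "J \<in> carrier_mat n n" "u \<in> carrier_vec n" "u' \<in> carrier_vec n"
  shows "bil (hplus J) (vCons a (vCons b u)) (vCons a' (vCons b' u')) = a * b' - b * a' + bil J u u'"
  using assms by (simp add: bil_def hplus_mult_vec)

lemma carrier_vec_Suc2E:
  assumes "x \<in> carrier_vec (Suc (Suc n))"
  obtains a b u where "x = vCons a (vCons b u)" "u \<in> carrier_vec n"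
  using assms by (metis carrier_vec_SucE)

text \<open>Splitting off a hyperbolic plane: the remaining coordinates are corrected by multiples of
  the hyperbolic pair so as to become orthogonal to it.\<close>

lemma split_hyperbolic_plane:
  fixes J :: "'a::field mat"
  assumes alt: "alt_form (Suc (Suc n)) J"
    and v: "v \<in> carrier_vec (Suc (Suc n))" "v \<noteq> 0\<^sub>v (Suc (Suc n))"
  shows "\<exists>P J0. injective_mat (Suc (Suc n)) P \<and> P *\<^sub>v vCons 1 (0\<^sub>v (Suc n)) = v \<and>
           alt_form n J0 \<and> transpose_mat P * J * P = hplus J0"
proof -
  let ?N = "Suc (Suc n)"
  note J = alt_form_carrier[OF alt]
  note bl = bil_add_left[OF J] bil_add_right[OF J] bil_smult_left[OF J] bil_smult_right[OF J]
  obtain w0 where w0: "w0 \<in> carrier_vec ?N" "bil J v w0 \<noteq> 0"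
    using bil_nondegenerate[OF alt v(1)] v(2) by blast
  \<comment> \<open>Scaling makes v and \<open>w1\<close> a hyperbolic pair. Completing to a basis
    may change \<open>w1\<close> by a multiple of v, which leaves its pairing with v intact.\<close>
  define w1 where "w1 = inverse (bil J v w0) \<cdot>\<^sub>v w0"
  have w1: "w1 \<in> carrier_vec ?N" "bil J v w1 = 1"
    using w0 v by (auto simp: w1_def bl)
  have "w1 \<noteq> k \<cdot>\<^sub>v v" for k
  proof
    assume "w1 = k \<cdot>\<^sub>v v"
    then have "bil J v w1 = 0" using v by (simp add: bl bil_self[OF alt])
    then show False using w1 by simp
  qed
  then obtain Q k where Q: "injective_mat ?N Q" "Q *\<^sub>v vCons 1 (0\<^sub>v (Suc n)) = v"
    "Q *\<^sub>v vCons 0 (vCons 1 (0\<^sub>v n)) + k \<cdot>\<^sub>v v = w1"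
    using complete_pair[OF v w1(1)] by blast
  note Qc = injective_mat_carrier[OF Q(1)]
  define w where "w = Q *\<^sub>v vCons 0 (vCons 1 (0\<^sub>v n))"
  have w: "w \<in> carrier_vec ?N" using Qc by (simp add: w_def)
  have "bil J v (w + k \<cdot>\<^sub>v v) = 1" using Q(3) w1 by (simp add: w_def)
  then have vw: "bil J v w = 1" using v w by (simp add: bl bil_self[OF alt])
  have wv: "bil J w v = -1" using bil_skew[OF alt v(1) w] vw by simp
  define \<iota> where "\<iota> u = Q *\<^sub>v vCons 0 (vCons 0 u)" for u
  have \<iota>: "\<iota> u \<in> carrier_vec ?N" if "u \<in> carrier_vec n" for u using Qc that by (simp add: \<iota>_def)
  define \<tau> where "\<tau> u = bil J w (\<iota> u) \<cdot>\<^sub>v v + (- bil J v (\<iota> u)) \<cdot>\<^sub>v w + \<iota> u" for u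
  have \<tau>: "\<tau> u \<in> carrier_vec ?N" if "u \<in> carrier_vec n" for u using v w \<iota>[OF that] by (simp add: \<tau>_def)
  have v\<tau>: "bil J v (\<tau> u) = 0" if "u \<in> carrier_vec n" for u
    using v w \<iota>[OF that] by (simp add: \<tau>_def bl vw bil_self[OF alt])
  have w\<tau>: "bil J w (\<tau> u) = 0" if "u \<in> carrier_vec n" for u
    using v w \<iota>[OF that] by (simp add: \<tau>_def bl wv bil_self[OF alt])
  have \<tau>v: "bil J (\<tau> u) v = 0" "bil J (\<tau> u) w = 0" if "u \<in> carrier_vec n" for u
    using bil_skew[OF alt v(1) \<tau>[OF that]] bil_skew[OF alt w \<tau>[OF that]] v\<tau>[OF that] w\<tau>[OF that] by auto
  have Q3: "Q *\<^sub>v vCons a (vCons b u) = a \<cdot>\<^sub>v v + b \<cdot>\<^sub>v w + \<iota> u" if u: "u \<in> carrier_vec n" for a b u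
  proof -
    have "vCons a (vCons b u) =
        a \<cdot>\<^sub>v vCons 1 (0\<^sub>v (Suc n)) + b \<cdot>\<^sub>v vCons 0 (vCons 1 (0\<^sub>v n)) + vCons 0 (vCons 0 u)"
      using u by (auto simp: zero_vec_Suc intro!: eq_vecI)
    then show ?thesis
      unfolding w_def \<iota>_def Q(2)[symmetric] using u
      by (simp only: mult_add_distrib_mat_vec[OF Qc] mult_mat_vec[OF Qc] add_carrier_vec
          smult_carrier_vec vCons_carrier_vec zero_carrier_vec)
  qed
  have \<tau>Q: "\<tau> u = Q *\<^sub>v vCons (bil J w (\<iota> u)) (vCons (- bil J v (\<iota> u)) u)" if "u \<in> carrier_vec n" for u
    using that by (simp add: Q3 \<tau>_def)
  have \<iota>_lin: "\<iota> (x + y) = \<iota> x + \<iota> y" "\<iota> (c \<cdot>\<^sub>v x) = c \<cdot>\<^sub>v \<iota> x"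
    if "x \<in> carrier_vec n" "y \<in> carrier_vec n" for x y c
    using that mult_add_distrib_mat_vec[OF Qc, of "vCons 0 (vCons 0 x)" "vCons 0 (vCons 0 y)"]
      mult_mat_vec[OF Qc, of "vCons 0 (vCons 0 x)" c] by (simp_all add: \<iota>_def)
  have "lin n ?N \<tau>"
    unfolding lin_def
  proof (intro conjI ballI allI)
    fix x y :: "'a vec" and c assume x: "x \<in> carrier_vec n"
    note ic = \<iota>[OF x] v(1) w
    show "\<tau> x \<in> carrier_vec ?N" by (rule \<tau>[OF x])
    show "\<tau> (c \<cdot>\<^sub>v x) = c \<cdot>\<^sub>v \<tau> x"
      using ic unfolding \<tau>_def \<iota>_lin(2)[OF x x]
      by (simp add: bl) (auto intro!: eq_vecI simp: algebra_simps)
    assume y: "y \<in> carrier_vec n"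
    show "\<tau> (x + y) = \<tau> x + \<tau> y"
      using ic \<iota>[OF y] unfolding \<tau>_def \<iota>_lin(1)[OF x y]
      by (simp add: bl) (auto intro!: eq_vecI simp: algebra_simps)
  qed
  then obtain T where T: "T \<in> carrier_mat ?N n" "\<And>x. x \<in> carrier_vec n \<Longrightarrow> T *\<^sub>v x = \<tau> x"
    using lin_matrix_ex by blast
  \<comment> \<open>\<open>T\<close> is rectangular: \<open>J0\<close> is the pullback of J along
    \<open>\<tau>\<close>, hence J restricted to a complement of the plane, written in n
    coordinates.\<close>
  define J0 where "J0 = transpose_mat T * J * T"
  have J0: "J0 \<in> carrier_mat n n" using T by (auto simp: J0_def)
  have bil0: "bil J0 x y = bil J (\<tau> x) (\<tau> y)" if "x \<in> carrier_vec n" "y \<in> carrier_vec n" for x y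
    unfolding J0_def using bil_congruence[OF J T(1) that] that T(2) by simp
  define f where "f x = x $ 0 \<cdot>\<^sub>v v + x $ 1 \<cdot>\<^sub>v w + \<tau> (vec n (\<lambda>i. x $ Suc (Suc i)))" for x
  have tl: "vec n (\<lambda>i. vCons a (vCons b u) $ Suc (Suc i)) = u" if "u \<in> carrier_vec n" for a b :: 'a and u
    using that by (auto intro!: eq_vecI)
  have f: "f (vCons a (vCons b u)) = a \<cdot>\<^sub>v v + b \<cdot>\<^sub>v w + \<tau> u" if "u \<in> carrier_vec n" for a b u
    unfolding f_def tl[OF that] by simp
  have "lin ?N ?N f"
    unfolding lin_def
  proof (intro conjI ballI allI)
    fix x y :: "'a vec" and c :: 'a assume "x \<in> carrier_vec ?N"
    then obtain a b x' where x: "x = vCons a (vCons b x')" "x' \<in> carrier_vec n"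
      by (rule carrier_vec_Suc2E)
    note ic = \<tau>[OF x(2)] v(1) w
    show "f x \<in> carrier_vec ?N" using x ic by (simp add: f)
    have "\<tau> (c \<cdot>\<^sub>v x') = c \<cdot>\<^sub>v \<tau> x'" using \<open>lin n ?N \<tau>\<close> x by (simp add: lin_def)
    then show "f (c \<cdot>\<^sub>v x) = c \<cdot>\<^sub>v f x"
      using x ic by (simp add: f) (auto intro!: eq_vecI simp: algebra_simps)
    assume "y \<in> carrier_vec ?N"
    then obtain a' b' y' where y: "y = vCons a' (vCons b' y')" "y' \<in> carrier_vec n"
      by (rule carrier_vec_Suc2E)
    have "\<tau> (x' + y') = \<tau> x' + \<tau> y'" using \<open>lin n ?N \<tau>\<close> x y by (simp add: lin_def)
    then show "f (x + y) = f x + f y"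
      using x y ic \<tau>[OF y(2)] by (simp add: f) (auto intro!: eq_vecI simp: algebra_simps)
  qed
  then obtain P where P: "P \<in> carrier_mat ?N ?N" "\<And>x. x \<in> carrier_vec ?N \<Longrightarrow> P *\<^sub>v x = f x"
    using lin_matrix_ex by blast
  have bilf: "bil J (f (vCons a (vCons b u))) (f (vCons a' (vCons b' u')))
      = a * b' - b * a' + bil J0 u u'" if u: "u \<in> carrier_vec n" "u' \<in> carrier_vec n" for a b u a' b' u'
    using v(1) w \<tau>[OF u(1)] \<tau>[OF u(2)]
    by (simp add: f u bl bil_self[OF alt] vw wv v\<tau> w\<tau> \<tau>v bil0)
  \<comment> \<open>In the basis \<open>Q\<close> the last n coordinates of \<open>\<tau> u\<close>
    are still u, because the correction lies in the plane.\<close>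
  have \<tau>0: "u = 0\<^sub>v n" if u: "u \<in> carrier_vec n" "\<tau> u = 0\<^sub>v ?N" for u
  proof -
    have "vCons (bil J w (\<iota> u)) (vCons (- bil J v (\<iota> u)) u) = 0\<^sub>v ?N"
      using u Q(1) by (simp add: \<tau>Q injective_mat_def)
    then show ?thesis by (simp add: zero_vec_Suc)
  qed
  have f0: "x = 0\<^sub>v ?N" if xc: "x \<in> carrier_vec ?N" and "f x = 0\<^sub>v ?N" for x
  proof -
    obtain a b u where x: "x = vCons a (vCons b u)" "u \<in> carrier_vec n"
      using xc by (rule carrier_vec_Suc2E)
    have fx: "a \<cdot>\<^sub>v v + b \<cdot>\<^sub>v w + \<tau> u = 0\<^sub>v ?N" using that x by (simp add: f)
    \<comment> \<open>Pairing with v and w reads off the plane coordinates b and -a.\<close>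
    have "bil J v (a \<cdot>\<^sub>v v + b \<cdot>\<^sub>v w + \<tau> u) = b" "bil J w (a \<cdot>\<^sub>v v + b \<cdot>\<^sub>v w + \<tau> u) = - a"
      using v(1) w \<tau>[OF x(2)] x by (simp_all add: bl bil_self[OF alt] vw wv v\<tau> w\<tau>)
    then have ab: "a = 0" "b = 0"
      unfolding fx using v(1) w by (simp_all add: bil_zero_right[OF J])
    have "\<tau> u = 0\<^sub>v ?N" using fx v(1) w \<tau>[OF x(2)] by (simp add: ab zero_smult_vec)
    then show ?thesis using \<tau>0 x by (simp add: ab zero_vec_Suc)
  qed
  have injP: "injective_mat ?N P"
    using P f0 by (simp add: injective_mat_def)
  then obtain R where R: "injective_mat ?N R" "P * R = 1\<^sub>m ?N"
    by (rule injective_mat_obtain_inverse)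
  have Rc: "R \<in> carrier_mat ?N ?N" by (rule injective_mat_carrier[OF R(1)])
  have surj: "\<exists>x\<in>carrier_vec ?N. f x = y" if "y \<in> carrier_vec ?N" for y
  proof
    show "R *\<^sub>v y \<in> carrier_vec ?N" using Rc that by simp
    show "f (R *\<^sub>v y) = y"
      using Rc that P(2)[of "R *\<^sub>v y"] assoc_mult_mat_vec[OF P(1) Rc that] R(2) by simp
  qed
  have "alt_form n J0"
  proof (rule alt_formI[OF J0])
    show "bil J0 x x = 0" if "x \<in> carrier_vec n" for x
      using that \<tau>[OF that] by (simp add: bil0 bil_self[OF alt])
    fix y :: "'a vec"
    assume y: "y \<in> carrier_vec n" and o: "\<And>x. x \<in> carrier_vec n \<Longrightarrow> bil J0 x y = 0"
    \<comment> \<open>\<open>\<tau> y\<close> is orthogonal to v and w by construction and to the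
      image of \<open>\<tau>\<close> by assumption; by \<open>surj\<close> these span the whole
      space.\<close>
    have "\<tau> y = 0\<^sub>v ?N"
    proof (rule bil_nondegenerate[OF alt \<tau>[OF y]])
      fix z :: "'a vec" assume z: "z \<in> carrier_vec ?N"
      then obtain x where "x \<in> carrier_vec ?N" and fx: "f x = z" using surj by blast
      then obtain a b u where x: "x = vCons a (vCons b u)" "u \<in> carrier_vec n"
        by (metis carrier_vec_Suc2E)
      have "bil J z (\<tau> y) = 0"
        using x o[OF x(2)] v(1) w \<tau>[OF x(2)] \<tau>[OF y] y by (simp add: fx[symmetric] f bl v\<tau> w\<tau> bil0)
      then show "bil J (\<tau> y) z = 0" using bil_skew[OF alt z \<tau>[OF y]] by simp
    qed
    then show "y = 0\<^sub>v n" using \<tau>0 y by simp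
  qed
  moreover have "P *\<^sub>v vCons 1 (0\<^sub>v (Suc n)) = v"
  proof -
    have "\<tau> (0\<^sub>v n) = 0\<^sub>v ?N" using T(2)[of "0\<^sub>v n"] mult_mat_zero_vec[OF T(1)] by simp
    then have "f (vCons 1 (vCons 0 (0\<^sub>v n))) = v" using v(1) w by (simp add: f zero_smult_vec)
    then show ?thesis by (simp add: P zero_vec_Suc)
  qed
  moreover have "transpose_mat P * J * P = hplus J0"
  proof (rule mat_eqI_bil)
    show "hplus J0 \<in> carrier_mat ?N ?N" using J0 by simp
    show "transpose_mat P * J * P \<in> carrier_mat ?N ?N" using P by auto
    fix x y :: "'a vec" assume xy: "x \<in> carrier_vec ?N" "y \<in> carrier_vec ?N"
    obtain a b u where x: "x = vCons a (vCons b u)" "u \<in> carrier_vec n"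
      using xy(1) by (rule carrier_vec_Suc2E)
    obtain a' b' u' where y: "y = vCons a' (vCons b' u')" "u' \<in> carrier_vec n"
      using xy(2) by (rule carrier_vec_Suc2E)
    show "bil (transpose_mat P * J * P) x y = bil (hplus J0) x y"
      using bil_congruence[OF J P(1) xy] xy
      by (simp add: P) (simp add: x y bilf bil_hplus[OF J0])
  qed
  ultimately show ?thesis using injP by blast
qed

section \<open>Isometries\<close>

text \<open>A form congruent to \<open>symplectic_form_mat n\<close>, arranged so that the first two
  coordinates split off orthogonally.\<close>

primrec hyp :: "nat \<Rightarrow> 'a::field mat" where
  "hyp 0 = 0\<^sub>m 0 0"
| "hyp (Suc n) = hplus (hyp n)"

lemma hyp_carrier [simp]: "hyp n \<in> carrier_mat (2 * n) (2 * n)"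
  by (induction n) auto

lemma alt_form_congruence:
  assumes alt: "alt_form n J" and P: "injective_mat n P"
  shows "alt_form n (transpose_mat P * J * P)"
proof -
  note J = alt_form_carrier[OF alt] and Pc = injective_mat_carrier[OF P]
  obtain Q where Q: "injective_mat n Q" "P * Q = 1\<^sub>m n"
    using injective_mat_obtain_inverse[OF P] .
  note Qc = injective_mat_carrier[OF Q(1)]
  show ?thesis
  proof (rule alt_formI)
    show "transpose_mat P * J * P \<in> carrier_mat n n" using J Pc by auto
    show "bil (transpose_mat P * J * P) x x = 0" if "x \<in> carrier_vec n" for x
      using that Pc by (simp add: bil_congruence[OF J Pc] bil_self[OF alt])
    fix y :: "'a vec" assume y: "y \<in> carrier_vec n"
      and o: "\<And>x. x \<in> carrier_vec n \<Longrightarrow> bil (transpose_mat P * J * P) x y = 0"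
    have "P *\<^sub>v y = 0\<^sub>v n"
    proof (rule bil_nondegenerate[OF alt])
      fix z :: "'a vec" assume z: "z \<in> carrier_vec n"
      have "P *\<^sub>v (Q *\<^sub>v z) = z" using assoc_mult_mat_vec[OF Pc Qc z] Q(2) z by simp
      then have "bil J z (P *\<^sub>v y) = 0"
        using o[of "Q *\<^sub>v z"] Qc z y by (simp add: bil_congruence[OF J Pc])
      then show "bil J (P *\<^sub>v y) z = 0"
        using bil_skew[OF alt z, of "P *\<^sub>v y"] Pc y by simp
    qed (use Pc y in simp)
    then show "y = 0\<^sub>v n" using P y by (simp add: injective_mat_def)
  qed
qed

lemma congruence_comp:
  fixes J :: "'a::field mat"
  assumes "J \<in> carrier_mat n n" "P \<in> carrier_mat n n" "Q \<in> carrier_mat n n"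
  shows "transpose_mat (P * Q) * J * (P * Q) = transpose_mat Q * (transpose_mat P * J * P) * Q"
proof (rule mat_eqI_bil)
  have PJP: "transpose_mat P * J * P \<in> carrier_mat n n" using assms by auto
  fix x y :: "'a vec" assume xy: "x \<in> carrier_vec n" "y \<in> carrier_vec n"
  then show "bil (transpose_mat (P * Q) * J * (P * Q)) x y
      = bil (transpose_mat Q * (transpose_mat P * J * P) * Q) x y"
    using assms bil_congruence[OF PJP assms(3) xy]
      bil_congruence[OF assms(1), of "P * Q" n x y]
      bil_congruence[OF assms(1,2), of "Q *\<^sub>v x" "Q *\<^sub>v y"]
    by (simp add: assoc_mult_mat_vec[of _ n n _ n])
qed (use assms in auto)

text \<open>\<open>Q\<close> acts as the identity on the plane and as \<open>P\<close> on its
  complement.\<close>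

lemma hplus_lift:
  fixes J :: "'a::field mat"
  assumes J: "J \<in> carrier_mat n n" and P: "injective_mat n P"
  shows "\<exists>Q. injective_mat (Suc (Suc n)) Q \<and> Q *\<^sub>v vCons 1 (0\<^sub>v (Suc n)) = vCons 1 (0\<^sub>v (Suc n)) \<and>
           transpose_mat Q * hplus J * Q = hplus (transpose_mat P * J * P)"
proof -
  let ?N = "Suc (Suc n)"
  note Pc = injective_mat_carrier[OF P]
  define f where "f x = vCons (x $ 0) (vCons (x $ 1) (P *\<^sub>v vec n (\<lambda>i. x $ Suc (Suc i))))" for x
  have tl: "vec n (\<lambda>i. vCons a (vCons b u) $ Suc (Suc i)) = u" if "u \<in> carrier_vec n" for a b :: 'a and u
    using that by (auto intro!: eq_vecI)
  have f: "f (vCons a (vCons b u)) = vCons a (vCons b (P *\<^sub>v u))" if "u \<in> carrier_vec n" for a b u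
    unfolding f_def tl[OF that] by simp
  have "lin ?N ?N f"
    unfolding lin_def
  proof (intro conjI ballI allI)
    fix x y :: "'a vec" and c :: 'a assume "x \<in> carrier_vec ?N"
    then obtain a b x' where x: "x = vCons a (vCons b x')" "x' \<in> carrier_vec n"
      by (rule carrier_vec_Suc2E)
    show "f x \<in> carrier_vec ?N" using x Pc by (simp add: f)
    show "f (c \<cdot>\<^sub>v x) = c \<cdot>\<^sub>v f x" using x Pc by (simp add: f mult_mat_vec[OF Pc])
    assume "y \<in> carrier_vec ?N"
    then obtain a' b' y' where y: "y = vCons a' (vCons b' y')" "y' \<in> carrier_vec n"
      by (rule carrier_vec_Suc2E)
    show "f (x + y) = f x + f y" using x y Pc by (simp add: f mult_add_distrib_mat_vec[OF Pc])
  qed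
  then obtain Q where Q: "Q \<in> carrier_mat ?N ?N" "\<And>x. x \<in> carrier_vec ?N \<Longrightarrow> Q *\<^sub>v x = f x"
    using lin_matrix_ex by blast
  have "injective_mat ?N Q"
    unfolding injective_mat_def
  proof (intro conjI ballI impI)
    fix x :: "'a vec" assume x0: "x \<in> carrier_vec ?N" "Q *\<^sub>v x = 0\<^sub>v ?N"
    obtain a b u where x: "x = vCons a (vCons b u)" "u \<in> carrier_vec n"
      using x0(1) by (rule carrier_vec_Suc2E)
    show "x = 0\<^sub>v ?N" using x0 x P by (simp add: Q f zero_vec_Suc injective_mat_def)
  qed (rule Q)
  moreover have "Q *\<^sub>v vCons 1 (0\<^sub>v (Suc n)) = vCons 1 (0\<^sub>v (Suc n))"
    using Pc by (simp add: Q) (simp add: zero_vec_Suc f)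
  moreover have "transpose_mat Q * hplus J * Q = hplus (transpose_mat P * J * P)"
  proof (rule mat_eqI_bil)
    have PJP: "transpose_mat P * J * P \<in> carrier_mat n n" using Pc J by auto
    show "hplus (transpose_mat P * J * P) \<in> carrier_mat ?N ?N" using PJP by simp
    show "transpose_mat Q * hplus J * Q \<in> carrier_mat ?N ?N" using Q J by auto
    fix x y :: "'a vec" assume xy: "x \<in> carrier_vec ?N" "y \<in> carrier_vec ?N"
    obtain a b u where x: "x = vCons a (vCons b u)" "u \<in> carrier_vec n"
      using xy(1) by (rule carrier_vec_Suc2E)
    obtain a' b' u' where y: "y = vCons a' (vCons b' u')" "u' \<in> carrier_vec n"
      using xy(2) by (rule carrier_vec_Suc2E)
    show "bil (transpose_mat Q * hplus J * Q) x y = bil (hplus (transpose_mat P * J * P)) x y"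
      using bil_congruence[OF hplus_carrier[OF J] Q(1) xy] xy x(2) y(2) Pc
      by (simp add: Q) (simp add: x y f bil_hplus[OF PJP] bil_hplus[OF J] bil_congruence[OF J Pc])
  qed
  ultimately show ?thesis by blast
qed

text \<open>A plane through the prescribed v is split off; its complement, where no vector is
  prescribed, is left to the induction hypothesis, so both claims are proved together. For J =
  \<open>hyp n\<close> the second claim is the transitivity of the isometry group on nonzero
  vectors.\<close>

lemma symplectic_basis:
  fixes J :: "'a::field mat"
  assumes "alt_form (2 * n) J"
  shows "\<exists>P. injective_mat (2 * n) P \<and> transpose_mat P * J * P = hyp n"
    and "\<And>v. v \<in> carrier_vec (2 * n) \<Longrightarrow> v \<noteq> 0\<^sub>v (2 * n) \<Longrightarrow>
       \<exists>P. injective_mat (2 * n) P \<and> P *\<^sub>v unit_vec (2 * n) 0 = v \<and> transpose_mat P * J * P = hyp n"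
proof (atomize (full), use assms in \<open>induction n arbitrary: J\<close>)
  case 0
  then show ?case
    by (auto intro!: exI[of _ "1\<^sub>m 0"] dest: alt_form_carrier)
next
  case (Suc n)
  have N: "2 * Suc n = Suc (Suc (2 * n))" by simp
  note alt = Suc.prems[unfolded N]
  have e: "unit_vec (Suc (Suc (2 * n))) 0 = vCons (1::'a) (0\<^sub>v (Suc (2 * n)))"
    by (auto simp: vec_eq_iff vec_index_vCons unit_vec_def)
  have *: "\<exists>P. injective_mat (2 * Suc n) P \<and> P *\<^sub>v unit_vec (2 * Suc n) 0 = v \<and>
      transpose_mat P * J * P = hyp (Suc n)"
    if v: "v \<in> carrier_vec (2 * Suc n)" "v \<noteq> 0\<^sub>v (2 * Suc n)" for v
  proof -
    obtain P J0 where P: "injective_mat (Suc (Suc (2 * n))) P" "P *\<^sub>v vCons 1 (0\<^sub>v (Suc (2 * n))) = v"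
      "alt_form (2 * n) J0" "transpose_mat P * J * P = hplus J0"
      using split_hyperbolic_plane[OF alt v[unfolded N]] by blast
    obtain P0 where P0: "injective_mat (2 * n) P0" "transpose_mat P0 * J0 * P0 = hyp n"
      using Suc.IH[OF P(3)] by blast
    obtain Q where Q: "injective_mat (Suc (Suc (2 * n))) Q"
      "Q *\<^sub>v vCons 1 (0\<^sub>v (Suc (2 * n))) = vCons 1 (0\<^sub>v (Suc (2 * n)))"
      "transpose_mat Q * hplus J0 * Q = hplus (hyp n)"
      using hplus_lift[OF alt_form_carrier[OF P(3)] P0(1)] unfolding P0(2) by blast
    note c = injective_mat_carrier[OF P(1)] injective_mat_carrier[OF Q(1)]
    show ?thesis
      unfolding N e hyp.simps
    proof (intro exI[of _ "P * Q"] conjI)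
      show "injective_mat (Suc (Suc (2 * n))) (P * Q)" by (rule injective_mat_mult[OF P(1) Q(1)])
      show "P * Q *\<^sub>v vCons 1 (0\<^sub>v (Suc (2 * n))) = v"
        using c by (subst assoc_mult_mat_vec[OF c]) (auto simp: P Q)
      show "transpose_mat (P * Q) * J * (P * Q) = hplus (hyp n)"
        unfolding congruence_comp[OF alt_form_carrier[OF alt] c] P(4) by (rule Q(3))
    qed
  qed
  have "unit_vec (2 * Suc n) 0 \<noteq> (0\<^sub>v (2 * Suc n) :: 'a vec)" by simp
  then show ?case using * by (meson unit_vec_carrier)
qed

section \<open>The isometry group of a form\<close>

definition isometries :: "nat \<Rightarrow> 'a::field mat \<Rightarrow> 'a mat set" where
  "isometries n J = {A \<in> carrier_mat n n. transpose_mat A * J * A = J}"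

lemma isometries_iff:
  fixes J :: "'a::field mat"
  assumes J: "J \<in> carrier_mat n n"
  shows "A \<in> isometries n J \<longleftrightarrow> A \<in> carrier_mat n n \<and>
    (\<forall>x\<in>carrier_vec n. \<forall>y\<in>carrier_vec n. bil J (A *\<^sub>v x) (A *\<^sub>v y) = bil J x y)"
proof
  assume "A \<in> isometries n J"
  then show "A \<in> carrier_mat n n \<and>
    (\<forall>x\<in>carrier_vec n. \<forall>y\<in>carrier_vec n. bil J (A *\<^sub>v x) (A *\<^sub>v y) = bil J x y)"
    using bil_congruence[OF J, of A n] by (auto simp: isometries_def)
next
  assume A: "A \<in> carrier_mat n n \<and>
    (\<forall>x\<in>carrier_vec n. \<forall>y\<in>carrier_vec n. bil J (A *\<^sub>v x) (A *\<^sub>v y) = bil J x y)"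
  have "transpose_mat A * J * A = J"
    by (rule mat_eqI_bil) (use A J bil_congruence[OF J, of A n] in auto)
  then show "A \<in> isometries n J" using A by (simp add: isometries_def)
qed

lemma isometries_injective:
  assumes alt: "alt_form n J" and A: "A \<in> isometries n J"
  shows "injective_mat n A"
  unfolding injective_mat_def
proof (intro conjI ballI impI)
  note J = alt_form_carrier[OF alt]
  show Ac: "A \<in> carrier_mat n n" using A by (simp add: isometries_def)
  fix x assume x: "x \<in> carrier_vec n" "A *\<^sub>v x = 0\<^sub>v n"
  show "x = 0\<^sub>v n"
  proof (rule bil_nondegenerate[OF alt x(1)])
    fix y :: "'a vec" assume y: "y \<in> carrier_vec n"
    have "bil J (A *\<^sub>v x) (A *\<^sub>v y) = bil J x y" using A x(1) y unfolding isometries_iff[OF J] by blast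
    then show "bil J x y = 0" using x(2) y Ac by (simp add: bil_zero_left[OF J])
  qed
qed

lemma isometries_mult:
  assumes J: "J \<in> carrier_mat n n" and A: "A \<in> isometries n J" and B: "B \<in> isometries n J"
  shows "A * B \<in> isometries n J"
  using A B unfolding isometries_iff[OF J] by (auto simp: assoc_mult_mat_vec[of _ n n _ n])

text \<open>\<open>Q\<close> inverts \<open>P\<close>, so \<open>Q * A * P\<close> is A expressed in
  the coordinates in which the form J becomes its congruent copy.\<close>

lemma isometries_conj:
  fixes J :: "'a::field mat"
  assumes J: "J \<in> carrier_mat n n" and P: "P \<in> carrier_mat n n" and Q: "Q \<in> carrier_mat n n"
    and PQ: "P * Q = 1\<^sub>m n" and A: "A \<in> isometries n J"
  shows "Q * A * P \<in> isometries n (transpose_mat P * J * P)"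
proof -
  have PJP: "transpose_mat P * J * P \<in> carrier_mat n n" using P J by auto
  have Ac: "A \<in> carrier_mat n n" using A by (simp add: isometries_def)
  have *: "P *\<^sub>v ((Q * A * P) *\<^sub>v x) = A *\<^sub>v (P *\<^sub>v x)" if "x \<in> carrier_vec n" for x
  proof -
    have "P *\<^sub>v ((Q * A * P) *\<^sub>v x) = (P * (Q * (A * P))) *\<^sub>v x"
      using P Q Ac that by (simp add: assoc_mult_mat_vec[of _ n n _ n])
    also have "P * (Q * (A * P)) = (P * Q) * (A * P)" using P Q Ac by (simp add: assoc_mult_mat[of _ n n _ n _ n])
    finally show ?thesis using P Ac that by (simp add: PQ assoc_mult_mat_vec[of _ n n _ n])
  qed
  show ?thesis
    unfolding isometries_iff[OF PJP]
  proof (intro conjI ballI)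
    show QAP: "Q * A * P \<in> carrier_mat n n" using P Q Ac by auto
    fix x y :: "'a vec" assume xy: "x \<in> carrier_vec n" "y \<in> carrier_vec n"
    then have c: "(Q * A * P) *\<^sub>v x \<in> carrier_vec n" "(Q * A * P) *\<^sub>v y \<in> carrier_vec n" using QAP by auto
    show "bil (transpose_mat P * J * P) ((Q * A * P) *\<^sub>v x) ((Q * A * P) *\<^sub>v y)
        = bil (transpose_mat P * J * P) x y"
      unfolding bil_congruence[OF J P c] bil_congruence[OF J P xy] *[OF xy(1)] *[OF xy(2)]
      using A xy P by (simp add: isometries_iff[OF J])
  qed
qed

section \<open>Counting over a finite field\<close>

lemma card_carrier_vec_field: "card (carrier_vec n :: 'a::finite vec set) = CARD('a) ^ n"
  and finite_carrier_vec_field: "finite (carrier_vec n :: 'a::finite vec set)"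
proof (atomize (full), induction n)
  case 0
  have "carrier_vec 0 = {vNil :: 'a vec}" by auto
  then show ?case by simp
next
  case (Suc n)
  have "bij_betw (\<lambda>(a, u). vCons a u) (UNIV \<times> carrier_vec n) (carrier_vec (Suc n) :: 'a vec set)"
    unfolding bij_betw_def inj_on_def by (auto elim!: carrier_vec_SucE)
  from bij_betw_same_card[OF this] bij_betw_finite[OF this] show ?case
    using Suc by (simp add: card_cartesian_product)
qed

definition subsp :: "nat \<Rightarrow> 'a::field vec set \<Rightarrow> bool" where
  "subsp n W \<longleftrightarrow> W \<subseteq> carrier_vec n \<and> 0\<^sub>v n \<in> W \<and> (\<forall>x\<in>W. \<forall>y\<in>W. x + y \<in> W) \<and>
     (\<forall>x\<in>W. \<forall>k. k \<cdot>\<^sub>v x \<in> W)"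

lemma subsp_carrier: "subsp n (carrier_vec n)"
  by (auto simp: subsp_def)

text \<open>A nonzero functional splits W into its kernel and the line through a vector
  \<open>z\<close> normalised to have value 1.\<close>

lemma card_kernel_functional:
  fixes W :: "'a::{finite,field} vec set"
  assumes W: "subsp n W"
    and add: "\<And>x y. x \<in> W \<Longrightarrow> y \<in> W \<Longrightarrow> \<phi> (x + y) = \<phi> x + \<phi> y"
    and smult: "\<And>x k. x \<in> W \<Longrightarrow> \<phi> (k \<cdot>\<^sub>v x) = k * \<phi> x"
    and nz: "w \<in> W" "\<phi> w \<noteq> (0::'a)"
  shows "card W = CARD('a) * card {x \<in> W. \<phi> x = 0}"
proof -
  have Wc: "W \<subseteq> carrier_vec n" and Wa: "\<And>x y. x \<in> W \<Longrightarrow> y \<in> W \<Longrightarrow> x + y \<in> W"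
    and Ws: "\<And>x k. x \<in> W \<Longrightarrow> k \<cdot>\<^sub>v x \<in> W"
    using W by (auto simp: subsp_def)
  define z where "z = inverse (\<phi> w) \<cdot>\<^sub>v w"
  have z: "z \<in> W" "\<phi> z = 1" using nz by (auto simp: z_def Ws smult)
  have zc: "z \<in> carrier_vec n" using z Wc by auto
  have cancel: "(- c) \<cdot>\<^sub>v z + (c \<cdot>\<^sub>v z + u) = u" "c \<cdot>\<^sub>v z + ((- c) \<cdot>\<^sub>v z + u) = u"
    if "u \<in> W" for u c
    using zc that Wc by (auto simp: vec_eq_iff)
  have \<phi>z: "\<phi> (c \<cdot>\<^sub>v z + u) = c + \<phi> u" if "u \<in> W" for c u
    using that by (simp add: add smult Ws z)
  have "bij_betw (\<lambda>(c, u). c \<cdot>\<^sub>v z + u) (UNIV \<times> {x \<in> W. \<phi> x = 0}) W"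
  proof (rule bij_betw_byWitness[where f' = "\<lambda>x. (\<phi> x, (- \<phi> x) \<cdot>\<^sub>v z + x)"])
    show "\<forall>p\<in>UNIV \<times> {x \<in> W. \<phi> x = 0}.
        (\<phi> (case p of (c, u) \<Rightarrow> c \<cdot>\<^sub>v z + u),
         (- \<phi> (case p of (c, u) \<Rightarrow> c \<cdot>\<^sub>v z + u)) \<cdot>\<^sub>v z + (case p of (c, u) \<Rightarrow> c \<cdot>\<^sub>v z + u)) = p"
      by (auto simp: \<phi>z cancel)
    show "\<forall>x\<in>W. (case (\<phi> x, (- \<phi> x) \<cdot>\<^sub>v z + x) of (c, u) \<Rightarrow> c \<cdot>\<^sub>v z + u) = x"
      by (auto simp: cancel)
    show "(\<lambda>(c, u). c \<cdot>\<^sub>v z + u) ` (UNIV \<times> {x \<in> W. \<phi> x = 0}) \<subseteq> W"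
      by (auto simp: Wa Ws z)
    show "(\<lambda>x. (\<phi> x, (- \<phi> x) \<cdot>\<^sub>v z + x)) ` W \<subseteq> UNIV \<times> {x \<in> W. \<phi> x = 0}"
      by (auto simp: Wa Ws z \<phi>z)
  qed
  from bij_betw_same_card[OF this] show ?thesis by (simp add: card_cartesian_product)
qed

lemma card_image_kernel_mat:
  fixes A :: "'a::{finite,field} mat"
  assumes A: "A \<in> carrier_mat n n"
  shows "card ((\<lambda>x. A *\<^sub>v x) ` carrier_vec n) * card {x \<in> carrier_vec n. A *\<^sub>v x = 0\<^sub>v n} = CARD('a) ^ n"
proof -
  let ?V = "carrier_vec n :: 'a vec set" and ?K = "{x \<in> carrier_vec n. A *\<^sub>v x = 0\<^sub>v n}"
  let ?f = "\<lambda>x. A *\<^sub>v x"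
  \<comment> \<open>Every nonempty fibre is a translate of the kernel.\<close>
  have fib: "card {x \<in> ?V. ?f x = y} = card ?K" if y: "y \<in> ?f ` ?V" for y
  proof -
    obtain x0 where x0: "x0 \<in> ?V" "y = ?f x0" using y by blast
    have "bij_betw (\<lambda>u. x0 + u) ?K {x \<in> ?V. ?f x = y}"
    proof (rule bij_betw_byWitness[where f' = "\<lambda>x. - x0 + x"])
      show "\<forall>u\<in>?K. - x0 + (x0 + u) = u" using x0 by (auto simp: vec_eq_iff)
      show "\<forall>x\<in>{x \<in> ?V. ?f x = y}. x0 + (- x0 + x) = x" using x0 by (auto simp: vec_eq_iff)
      show "(\<lambda>u. x0 + u) ` ?K \<subseteq> {x \<in> ?V. ?f x = y}"
        using x0 A by (auto simp: mult_add_distrib_mat_vec[OF A])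
      have *: "?f (- x0) = - ?f x0"
        using x0 A by (intro eq_vecI) (auto simp: scalar_prod_uminus_right)
      have "?f (- x0 + x) = 0\<^sub>v n" if "x \<in> ?V" "?f x = ?f x0" for x
        using that x0 A by (simp add: mult_add_distrib_mat_vec[OF A] *)
      then show "(\<lambda>x. - x0 + x) ` {x \<in> ?V. ?f x = y} \<subseteq> ?K" using x0 by auto
    qed
    then show ?thesis by (rule bij_betw_same_card[symmetric])
  qed
  have "card ?V = (\<Sum>y\<in>?f ` ?V. card {x \<in> ?V. ?f x = y})"
    using sum.image_gen[OF finite_carrier_vec_field[of n, where 'a = 'a], of "\<lambda>_. 1::nat" ?f] by simp
  also have "\<dots> = card (?f ` ?V) * card ?K" using fib by simp
  finally show ?thesis by (simp add: card_carrier_vec_field)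
qed

lemma sum_card_swap:
  assumes "finite A" "finite B"
  shows "(\<Sum>a\<in>A. card {b \<in> B. R a b}) = (\<Sum>b\<in>B. card {a \<in> A. R a b})"
proof -
  have "(\<Sum>a\<in>A. card {b \<in> B. R a b}) = (\<Sum>a\<in>A. \<Sum>b\<in>B. if R a b then 1 else 0)"
    by (simp only: card_eq_sum sum.inter_filter[OF assms(2)])
  also have "\<dots> = (\<Sum>b\<in>B. \<Sum>a\<in>A. if R a b then 1 else 0)" by (rule sum.swap)
  also have "\<dots> = (\<Sum>b\<in>B. card {a \<in> A. R a b})"
    by (simp only: card_eq_sum sum.inter_filter[OF assms(1)])
  finally show ?thesis .
qed

lemma CARD_field_ge_2: "CARD('a::{finite,field}) \<ge> 2"
proof -
  have "card {0, 1 :: 'a} \<le> CARD('a)" by (intro card_mono) auto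
  then show ?thesis by simp
qed

text \<open>Count the orthogonal pairs of a vector and an element of \<open>W\<close> in two ways.\<close>

lemma card_perp:
  fixes W :: "'a::{finite,field} vec set"
  assumes alt: "alt_form n J" and W: "subsp n W"
  shows "card {x \<in> carrier_vec n. \<forall>u\<in>W. bil J x u = 0} * card W = CARD('a) ^ n"
proof -
  let ?V = "carrier_vec n :: 'a vec set" and ?P = "{x \<in> carrier_vec n. \<forall>u\<in>W. bil J x u = 0}"
  let ?q = "real CARD('a)"
  note J = alt_form_carrier[OF alt]
  have WV: "W \<subseteq> ?V" and W0: "0\<^sub>v n \<in> W" using W by (auto simp: subsp_def)
  note fin = finite_carrier_vec_field[of n, where 'a = 'a]
  have finW: "finite W" using WV fin by (rule finite_subset)
  have q: "?q \<ge> 2" using CARD_field_ge_2[where 'a = 'a] by simp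
  \<comment> \<open>All counts carry a factor q to avoid division. The vectors orthogonal to a
    nonzero u form a hyperplane, while u = 0 is orthogonal to all; counting by x separates the
    orthogonal complement of W in the same way.\<close>
  have row: "?q * card {x \<in> ?V. bil J x u = 0} = (if u = 0\<^sub>v n then ?q * ?q ^ n else ?q ^ n)" if "u \<in> W" for u
  proof (cases "u = 0\<^sub>v n")
    case True
    then have "{x \<in> ?V. bil J x u = 0} = ?V" using bil_zero_right[OF J] by auto
    then show ?thesis using True by (simp add: card_carrier_vec_field)
  next
    case False
    have uc: "u \<in> ?V" using that WV by auto
    then obtain y where "y \<in> ?V" "bil J u y \<noteq> 0" using bil_nondegenerate[OF alt uc] False by blast
    then have y: "y \<in> ?V" "bil J y u \<noteq> 0" using bil_skew[OF alt uc] by auto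
    have "card ?V = CARD('a) * card {x \<in> ?V. bil J x u = 0}"
      by (rule card_kernel_functional[where \<phi> = "\<lambda>x. bil J x u" and w = y, OF subsp_carrier])
        (use uc y in \<open>auto simp: bil_add_left[OF J] bil_smult_left[OF J]\<close>)
    then show ?thesis using False by (simp add: card_carrier_vec_field flip: of_nat_mult of_nat_power)
  qed
  have col: "?q * card {u \<in> W. bil J x u = 0} = (if x \<in> ?P then ?q * card W else card W)" if x: "x \<in> ?V" for x
  proof (cases "x \<in> ?P")
    case True
    then have "{u \<in> W. bil J x u = 0} = W" by auto
    then show ?thesis using True by simp
  next
    case False
    then obtain y where y: "y \<in> W" "bil J x y \<noteq> 0" using x by auto
    have "card W = CARD('a) * card {u \<in> W. bil J x u = 0}"
      by (rule card_kernel_functional[where \<phi> = "bil J x" and w = y, OF W])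
        (use x y WV in \<open>auto simp: bil_add_right[OF J] bil_smult_right[OF J] subset_iff\<close>)
    from arg_cong[OF this, of real] show ?thesis unfolding if_not_P[OF False] by simp
  qed
  have "(\<Sum>u\<in>W. real (card {x \<in> ?V. bil J x u = 0})) = (\<Sum>x\<in>?V. real (card {u \<in> W. bil J x u = 0}))"
    using sum_card_swap[OF finW fin, of "\<lambda>u x. bil J x u = 0"] by (simp flip: of_nat_sum)
  then have "(\<Sum>u\<in>W. ?q * real (card {x \<in> ?V. bil J x u = 0})) = (\<Sum>x\<in>?V. ?q * real (card {u \<in> W. bil J x u = 0}))"
    by (simp flip: sum_distrib_left)
  then have "(\<Sum>u\<in>W. if u = 0\<^sub>v n then ?q * ?q ^ n else ?q ^ n) = (\<Sum>x\<in>?V. if x \<in> ?P then ?q * card W else card W)"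
    by (simp add: row col cong: sum.cong)
  also have "(\<Sum>u\<in>W. if u = 0\<^sub>v n then ?q * ?q ^ n else ?q ^ n)
      = ?q * ?q ^ n + (real (card W) - 1) * ?q ^ n"
  proof -
    have "card W > 0" using W0 finW by (auto simp: card_gt_0_iff)
    then show ?thesis using finW W0
      by (subst sum.remove[OF finW W0]) (simp add: card_Diff_singleton of_nat_diff)
  qed
  also have "(\<Sum>x\<in>?V. if x \<in> ?P then ?q * card W else card W)
      = ?q * card W * card ?P + card W * (?q ^ n - card ?P)"
  proof -
    have "(\<Sum>x\<in>?V. if x \<in> ?P then ?q * card W else card W)
       = (\<Sum>x\<in>?V. (if x \<in> ?P then ?q * card W - card W else 0) + card W)"
      by (intro sum.cong) auto
    also have "\<dots> = card ?P * (?q * card W - card W) + ?q ^ n * card W"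
      using fin by (simp add: sum.distrib card_carrier_vec_field flip: sum.inter_filter)
    finally show ?thesis by (simp add: algebra_simps)
  qed
  finally have "(?q - 1) * (card ?P * card W) = (?q - 1) * ?q ^ n" by (simp add: algebra_simps)
  then have "real (card ?P * card W) = real (CARD('a) ^ n)" using q by simp
  then show ?thesis by (simp only: of_nat_eq_iff)
qed

lemma fixed_vectors_carrier: "h \<in> carrier_mat n n \<Longrightarrow> fixed_vectors h = {v \<in> carrier_vec n. h *\<^sub>v v = v}"
  by (auto simp: fixed_vectors_def)

lemma subsp_fixed_vectors:
  assumes h: "h \<in> carrier_mat n n"
  shows "subsp n (fixed_vectors h)"
  using h by (auto simp: subsp_def fixed_vectors_carrier mult_add_distrib_mat_vec[OF h] mult_mat_vec[OF h])

lemma finite_fixed_vectors [simp]: "finite (fixed_vectors (h :: 'a::{finite,field} mat))"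
  unfolding fixed_vectors_def
  using finite_carrier_vec_field by (rule rev_finite_subset) auto


text \<open>The inclusion of the image of \<open>1 - h\<close> in the orthogonal complement of the fixed space is
  an equality, because the two have the same size.\<close>

lemma perp_fixed_vectors:
  fixes h :: "'a::{finite,field} mat"
  assumes alt: "alt_form n J" and h: "h \<in> isometries n J"
  shows "{w \<in> carrier_vec n. \<forall>u\<in>fixed_vectors h. bil J w u = 0} = (\<lambda>x. x - h *\<^sub>v x) ` carrier_vec n"
    and "card ((\<lambda>x. x - h *\<^sub>v x) ` carrier_vec n) * card (fixed_vectors h) = CARD('a) ^ n"
proof -
  let ?I = "(\<lambda>x. x - h *\<^sub>v x) ` carrier_vec n"
  note J = alt_form_carrier[OF alt]
  have hc: "h \<in> carrier_mat n n" using h by (simp add: isometries_def)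
  let ?M = "1\<^sub>m n - h"
  have M: "?M \<in> carrier_mat n n" using hc by auto
  have Mx: "?M *\<^sub>v x = x - h *\<^sub>v x" if "x \<in> carrier_vec n" for x :: "'a vec"
    using hc that by (simp add: minus_mult_distrib_mat_vec[of _ n n])
  have "x - h *\<^sub>v x = 0\<^sub>v n \<longleftrightarrow> h *\<^sub>v x = x" if "x \<in> carrier_vec n" for x :: "'a vec"
    using hc that by (auto simp: vec_eq_iff)
  then have "{x \<in> carrier_vec n. ?M *\<^sub>v x = 0\<^sub>v n} = fixed_vectors h"
    using Mx by (auto simp: fixed_vectors_carrier[OF hc])
  moreover have "(\<lambda>x. ?M *\<^sub>v x) ` carrier_vec n = ?I" by (intro image_cong) (auto simp: Mx)
  ultimately show c: "card ?I * card (fixed_vectors h) = CARD('a) ^ n"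
    using card_image_kernel_mat[OF M] by simp
  have sub: "?I \<subseteq> {w \<in> carrier_vec n. \<forall>u\<in>fixed_vectors h. bil J w u = 0}"
  proof (intro image_subsetI CollectI conjI ballI)
    fix x :: "'a vec" assume x: "x \<in> carrier_vec n"
    show "x - h *\<^sub>v x \<in> carrier_vec n" using hc x by simp
    fix u assume u: "u \<in> fixed_vectors h"
    have u': "u \<in> carrier_vec n" "h *\<^sub>v u = u" using u by (auto simp: fixed_vectors_carrier[OF hc])
    \<comment> \<open>Since u is fixed, pairing with u cannot tell x from its image under h.\<close>
    have "bil J (h *\<^sub>v x) (h *\<^sub>v u) = bil J x u"
      using h x u' unfolding isometries_iff[OF J] by blast
    moreover have "bil J x u = bil J ((x - h *\<^sub>v x) + h *\<^sub>v x) u"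
      using hc x by (intro arg_cong2[where f = "bil J"] eq_vecI) auto
    ultimately show "bil J (x - h *\<^sub>v x) u = 0"
      using hc x u' by (simp add: bil_add_left[OF J])
  qed
  have "card {w \<in> carrier_vec n. \<forall>u\<in>fixed_vectors h. bil J w u = 0} * card (fixed_vectors h) = CARD('a) ^ n"
    by (rule card_perp[OF alt subsp_fixed_vectors[OF hc]])
  then have "card {w \<in> carrier_vec n. \<forall>u\<in>fixed_vectors h. bil J w u = 0} * card (fixed_vectors h)
      = card ?I * card (fixed_vectors h)" using c by (rule trans[OF _ sym])
  moreover have "card (fixed_vectors h) \<noteq> 0"
    using subsp_fixed_vectors[OF hc] by (auto simp: card_eq_0_iff subsp_def)
  ultimately have "card {w \<in> carrier_vec n. \<forall>u\<in>fixed_vectors h. bil J w u = 0} = card ?I"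
    by simp
  then show "{w \<in> carrier_vec n. \<forall>u\<in>fixed_vectors h. bil J w u = 0} = ?I"
    using card_subset_eq[OF _ sub] finite_carrier_vec_field[of n, where 'a = 'a] by simp
qed

section \<open>The stabiliser of a vector\<close>

text \<open>In coordinates adapted to \<open>hplus J\<close>, an isometry fixing the first basis vector is determined
  by its action \<open>h\<close> on the last \<open>m\<close> coordinates and by the image \<open>(c, 1, w)\<close> of the second basis
  vector.\<close>

definition stab_fun :: "nat \<Rightarrow> 'a::field mat \<Rightarrow> 'a mat \<Rightarrow> 'a vec \<Rightarrow> 'a \<Rightarrow> 'a vec \<Rightarrow> 'a vec" where
  "stab_fun m J h w c x = (let u = vec m (\<lambda>i. x $ Suc (Suc i)); b = x $ 1 in
     vCons (x $ 0 + c * b + bil J w (h *\<^sub>v u)) (vCons b (b \<cdot>\<^sub>v w + h *\<^sub>v u)))"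

definition stab_mat :: "nat \<Rightarrow> 'a::field mat \<Rightarrow> 'a mat \<Rightarrow> 'a vec \<Rightarrow> 'a \<Rightarrow> 'a mat" where
  "stab_mat m J h w c = mat_of (Suc (Suc m)) (Suc (Suc m)) (stab_fun m J h w c)"

definition stabiliser :: "nat \<Rightarrow> 'a::field mat \<Rightarrow> 'a mat set" where
  "stabiliser m J = {g \<in> isometries (Suc (Suc m)) (hplus J).
     g *\<^sub>v vCons 1 (0\<^sub>v (Suc m)) = vCons 1 (0\<^sub>v (Suc m))}"

lemma stab_fun_vCons:
  assumes "u \<in> carrier_vec m"
  shows "stab_fun m J h w c (vCons a (vCons b u)) =
    vCons (a + c * b + bil J w (h *\<^sub>v u)) (vCons b (b \<cdot>\<^sub>v w + h *\<^sub>v u))"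
proof -
  have "vec m (\<lambda>i. vCons a (vCons b u) $ Suc (Suc i)) = u"
    using assms by (auto intro!: eq_vecI)
  then show ?thesis unfolding stab_fun_def Let_def by simp
qed

lemma vCons3_decomp:
  fixes u :: "'a::comm_ring_1 vec"
  assumes "u \<in> carrier_vec n"
  shows "vCons a (vCons b u) =
    a \<cdot>\<^sub>v vCons 1 (0\<^sub>v (Suc n)) + b \<cdot>\<^sub>v vCons 0 (vCons 1 (0\<^sub>v n)) + vCons 0 (vCons 0 u)"
  using assms by (auto simp: zero_vec_Suc intro!: eq_vecI)

context
  fixes J :: "'a::field mat" and m
  assumes alt: "alt_form m J"
begin

private lemmas J = alt_form_carrier[OF alt]
private lemmas bl = bil_add_left[OF J] bil_add_right[OF J] bil_smult_left[OF J] bil_smult_right[OF J]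

lemma stab_mat_mult_vec:
  assumes h: "h \<in> carrier_mat m m" and w: "w \<in> carrier_vec m" and u: "u \<in> carrier_vec m"
  shows "stab_mat m J h w c *\<^sub>v vCons a (vCons b u) =
    vCons (a + c * b + bil J w (h *\<^sub>v u)) (vCons b (b \<cdot>\<^sub>v w + h *\<^sub>v u))"
proof -
  let ?N = "Suc (Suc m)"
  have "lin ?N ?N (stab_fun m J h w c)"
    unfolding lin_def
  proof (intro conjI ballI allI)
    fix x y :: "'a vec" and k :: 'a assume "x \<in> carrier_vec ?N"
    then obtain a b x' where x: "x = vCons a (vCons b x')" "x' \<in> carrier_vec m"
      by (rule carrier_vec_Suc2E)
    have hx: "h *\<^sub>v x' \<in> carrier_vec m" using h x by simp
    show "stab_fun m J h w c x \<in> carrier_vec ?N" using x h w by (simp add: stab_fun_vCons)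
    have "(k * b) \<cdot>\<^sub>v w + k \<cdot>\<^sub>v (h *\<^sub>v x') = k \<cdot>\<^sub>v (b \<cdot>\<^sub>v w + h *\<^sub>v x')"
      using w hx h by (intro eq_vecI) (auto simp: algebra_simps)
    then show "stab_fun m J h w c (k \<cdot>\<^sub>v x) = k \<cdot>\<^sub>v stab_fun m J h w c x"
      using x h w hx by (simp add: stab_fun_vCons mult_mat_vec[OF h] bl distrib_left mult.left_commute)
    assume "y \<in> carrier_vec ?N"
    then obtain a' b' y' where y: "y = vCons a' (vCons b' y')" "y' \<in> carrier_vec m"
      by (rule carrier_vec_Suc2E)
    have hy: "h *\<^sub>v y' \<in> carrier_vec m" using h y by simp
    have "(b + b') \<cdot>\<^sub>v w + (h *\<^sub>v x' + h *\<^sub>v y') = (b \<cdot>\<^sub>v w + h *\<^sub>v x') + (b' \<cdot>\<^sub>v w + h *\<^sub>v y')"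
      using w hx hy h by (intro eq_vecI) (auto simp: algebra_simps)
    then show "stab_fun m J h w c (x + y) = stab_fun m J h w c x + stab_fun m J h w c y"
      using x y w hx hy h by (simp add: stab_fun_vCons mult_add_distrib_mat_vec[OF h] bl algebra_simps)
  qed
  then show ?thesis
    using u by (simp add: stab_mat_def mat_of_mult_vec stab_fun_vCons)
qed

lemma stab_mat_carrier [simp]: "stab_mat m J h w c \<in> carrier_mat (Suc (Suc m)) (Suc (Suc m))"
  by (simp add: stab_mat_def)

lemma stab_mat_in_stabiliser:
  assumes h: "h \<in> isometries m J" and w: "w \<in> carrier_vec m"
  shows "stab_mat m J h w c \<in> stabiliser m J"
proof -
  let ?N = "Suc (Suc m)" and ?g = "stab_mat m J h w c"
  have hc: "h \<in> carrier_mat m m" using h by (simp add: isometries_def)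
  note gv = stab_mat_mult_vec[OF hc w]
  have "?g \<in> isometries ?N (hplus J)"
    unfolding isometries_iff[OF hplus_carrier[OF J]]
  proof (intro conjI ballI)
    fix x y :: "'a vec" assume xy: "x \<in> carrier_vec ?N" "y \<in> carrier_vec ?N"
    obtain a b u where x: "x = vCons a (vCons b u)" "u \<in> carrier_vec m"
      using xy(1) by (rule carrier_vec_Suc2E)
    obtain a' b' u' where y: "y = vCons a' (vCons b' u')" "u' \<in> carrier_vec m"
      using xy(2) by (rule carrier_vec_Suc2E)
    have hu: "h *\<^sub>v u \<in> carrier_vec m" "h *\<^sub>v u' \<in> carrier_vec m" using hc x y by auto
    have "bil J (h *\<^sub>v u) (h *\<^sub>v u') = bil J u u'" using h x(2) y(2) unfolding isometries_iff[OF J] by blast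
    \<comment> \<open>Skew symmetry makes the mixed terms in w and h cancel against those
      contributed by the first coordinates.\<close>
    moreover have "bil J (h *\<^sub>v u) w = - bil J w (h *\<^sub>v u)" by (rule bil_skew[OF alt w hu(1)])
    ultimately show "bil (hplus J) (?g *\<^sub>v x) (?g *\<^sub>v y) = bil (hplus J) x y"
      using x y hu w
      by (simp add: gv bil_hplus[OF J] bl bil_self[OF alt] algebra_simps)
  qed simp
  moreover have "?g *\<^sub>v vCons 1 (vCons 0 (0\<^sub>v m)) = vCons 1 (vCons 0 (0\<^sub>v m))"
    using hc w by (simp add: gv zero_smult_vec bil_zero_right[OF J])
  ultimately show ?thesis by (simp add: stabiliser_def zero_vec_Suc)
qed

lemma stab_mat_surj:
  assumes "g \<in> stabiliser m J"
  shows "\<exists>h\<in>isometries m J. \<exists>w\<in>carrier_vec m. \<exists>c. g = stab_mat m J h w c"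
proof -
  let ?N = "Suc (Suc m)"
  note HJ = hplus_carrier[OF J]
  have g: "g \<in> carrier_mat ?N ?N" and ge: "g *\<^sub>v vCons 1 (0\<^sub>v (Suc m)) = vCons 1 (0\<^sub>v (Suc m))"
    and iso: "\<And>x y. x \<in> carrier_vec ?N \<Longrightarrow> y \<in> carrier_vec ?N \<Longrightarrow>
       bil (hplus J) (g *\<^sub>v x) (g *\<^sub>v y) = bil (hplus J) x y"
    using assms unfolding stabiliser_def isometries_iff[OF HJ] by blast+
  \<comment> \<open>Pairing with the first basis vector reads off the second coordinate; as g fixes
    that vector, g preserves this coordinate.\<close>
  have second: "\<exists>a' u'. g *\<^sub>v vCons a (vCons b u) = vCons a' (vCons b u') \<and> u' \<in> carrier_vec m"
    if u: "u \<in> carrier_vec m" for a b u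
  proof -
    have "g *\<^sub>v vCons a (vCons b u) \<in> carrier_vec ?N" using g u by simp
    then obtain a' b' u' where e: "g *\<^sub>v vCons a (vCons b u) = vCons a' (vCons b' u')" "u' \<in> carrier_vec m"
      by (rule carrier_vec_Suc2E)
    have "bil (hplus J) (vCons 1 (vCons 0 (0\<^sub>v m))) (vCons a' (vCons b' u'))
        = bil (hplus J) (vCons 1 (vCons 0 (0\<^sub>v m))) (vCons a (vCons b u))"
      using iso[of "vCons 1 (0\<^sub>v (Suc m))" "vCons a (vCons b u)"] u e ge
      by (simp add: zero_vec_Suc)
    then have "b' = b" using u e(2) by (simp add: bil_hplus[OF J] bil_zero_left[OF J])
    with e show ?thesis by blast
  qed
  obtain c w where cw: "g *\<^sub>v vCons 0 (vCons 1 (0\<^sub>v m)) = vCons c (vCons 1 w)" "w \<in> carrier_vec m"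
    using second[of "0\<^sub>v m" 0 1] by auto
  define t where "t x = vec m (\<lambda>i. x $ Suc (Suc i))" for x :: "'a vec"
  have t: "t (vCons a (vCons b u)) = u" if "u \<in> carrier_vec m" for a b u
    using that by (auto simp: t_def intro!: eq_vecI)
  \<comment> \<open>\<open>f\<close> is the action of g on the orthogonal complement of the fixed
    vector, taken modulo that vector.\<close>
  define f where "f u = t (g *\<^sub>v vCons 0 (vCons 0 u))" for u
  define \<beta> where "\<beta> u = (g *\<^sub>v vCons 0 (vCons 0 u)) $ 0" for u
  have gu: "g *\<^sub>v vCons 0 (vCons 0 u) = vCons (\<beta> u) (vCons 0 (f u))" "f u \<in> carrier_vec m"
    if "u \<in> carrier_vec m" for u
    using second[OF that, of 0 0] unfolding f_def \<beta>_def by (auto simp: t)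
  have "lin m m f"
    unfolding lin_def
  proof (intro conjI ballI allI)
    fix x y :: "'a vec" and k :: 'a assume x: "x \<in> carrier_vec m"
    show "f x \<in> carrier_vec m" by (rule gu[OF x])
    have "g *\<^sub>v (k \<cdot>\<^sub>v vCons 0 (vCons 0 x)) = k \<cdot>\<^sub>v (g *\<^sub>v vCons 0 (vCons 0 x))"
      using x by (intro mult_mat_vec[OF g]) simp
    then show "f (k \<cdot>\<^sub>v x) = k \<cdot>\<^sub>v f x"
      using x gu[OF x] gu[of "k \<cdot>\<^sub>v x"] by simp
    assume y: "y \<in> carrier_vec m"
    have "g *\<^sub>v (vCons 0 (vCons 0 x) + vCons 0 (vCons 0 y))
        = g *\<^sub>v vCons 0 (vCons 0 x) + g *\<^sub>v vCons 0 (vCons 0 y)"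
      using x y by (intro mult_add_distrib_mat_vec[OF g]) simp_all
    then show "f (x + y) = f x + f y"
      using x y gu[OF x] gu[OF y] gu[of "x + y"] by simp
  qed
  then have hf: "mat_of m m f *\<^sub>v u = f u" if "u \<in> carrier_vec m" for u
    using that by (rule mat_of_mult_vec)
  let ?h = "mat_of m m f"
  have h: "?h \<in> isometries m J"
    unfolding isometries_iff[OF J]
  proof (intro conjI ballI)
    fix x y :: "'a vec" assume xy: "x \<in> carrier_vec m" "y \<in> carrier_vec m"
    show "bil J (?h *\<^sub>v x) (?h *\<^sub>v y) = bil J x y"
      using iso[of "vCons 0 (vCons 0 x)" "vCons 0 (vCons 0 y)"] xy gu[OF xy(1)] gu[OF xy(2)]
      by (simp add: hf bil_hplus[OF J])
  qed simp
  \<comment> \<open>The second basis vector is orthogonal to \<open>vCons 0 (vCons 0 u)\<close>.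
    Preserving this orthogonality leaves no freedom for the first coordinate, which explains the
    term \<open>bil J w (h u)\<close> in \<open>stab_fun\<close>.\<close>
  have \<beta>: "\<beta> u = bil J w (?h *\<^sub>v u)" if "u \<in> carrier_vec m" for u
    using iso[of "vCons 0 (vCons 1 (0\<^sub>v m))" "vCons 0 (vCons 0 u)"] that gu[OF that] cw
    by (simp add: hf bil_hplus[OF J] bil_zero_left[OF J])
  have "g = stab_mat m J ?h w c"
  proof (rule mat_eqI_mult_vec[OF g stab_mat_carrier])
    fix x :: "'a vec" assume "x \<in> carrier_vec ?N"
    then obtain a b u where x: "x = vCons a (vCons b u)" "u \<in> carrier_vec m"
      by (rule carrier_vec_Suc2E)
    have "g *\<^sub>v x = a \<cdot>\<^sub>v (g *\<^sub>v vCons 1 (0\<^sub>v (Suc m))) + b \<cdot>\<^sub>v (g *\<^sub>v vCons 0 (vCons 1 (0\<^sub>v m)))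
        + g *\<^sub>v vCons 0 (vCons 0 u)"
      unfolding x(1) vCons3_decomp[OF x(2), of a b] using x(2)
      by (simp only: mult_add_distrib_mat_vec[OF g] mult_mat_vec[OF g] add_carrier_vec
          smult_carrier_vec vCons_carrier_vec zero_carrier_vec)
    also have "\<dots> = a \<cdot>\<^sub>v vCons 1 (0\<^sub>v (Suc m)) + b \<cdot>\<^sub>v vCons c (vCons 1 w) + vCons (\<beta> u) (vCons 0 (f u))"
      by (simp only: ge cw(1) gu(1)[OF x(2)])
    also have "\<dots> = stab_mat m J ?h w c *\<^sub>v x"
      using x cw(2) gu(2)[OF x(2)]
      by (simp add: stab_mat_mult_vec hf \<beta> zero_vec_Suc)
        (auto simp: mult.commute intro!: eq_vecI)
    finally show "g *\<^sub>v x = stab_mat m J ?h w c *\<^sub>v x" .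
  qed
  then show ?thesis using h cw(2) by blast
qed

lemma stab_mat_inj:
  assumes "h \<in> carrier_mat m m" "w \<in> carrier_vec m" "h' \<in> carrier_mat m m" "w' \<in> carrier_vec m"
    and eq: "stab_mat m J h w c = stab_mat m J h' w' c'"
  shows "h = h' \<and> w = w' \<and> c = c'"
proof -
  have "stab_mat m J h w c *\<^sub>v vCons 0 (vCons 1 (0\<^sub>v m)) = stab_mat m J h' w' c' *\<^sub>v vCons 0 (vCons 1 (0\<^sub>v m))"
    by (simp add: eq)
  then have cw: "c = c' \<and> w = w'"
    using assms(1-4) by (simp add: stab_mat_mult_vec bil_zero_right[OF J])
  have "h *\<^sub>v u = h' *\<^sub>v u" if u: "u \<in> carrier_vec m" for u
  proof -
    have "stab_mat m J h w c *\<^sub>v vCons 0 (vCons 0 u) = stab_mat m J h' w' c' *\<^sub>v vCons 0 (vCons 0 u)"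
      by (simp add: eq)
    then show ?thesis using assms(1-4) u by (simp add: stab_mat_mult_vec zero_smult_vec)
  qed
  then have "h = h'" by (rule mat_eqI_mult_vec[OF assms(1,3)])
  with cw show ?thesis by simp
qed

lemma bij_betw_stab_mat:
  "bij_betw (\<lambda>(h, w, c). stab_mat m J h w c) (isometries m J \<times> carrier_vec m \<times> UNIV) (stabiliser m J)"
  unfolding bij_betw_def
proof
  show "inj_on (\<lambda>(h, w, c). stab_mat m J h w c) (isometries m J \<times> carrier_vec m \<times> UNIV)"
    unfolding inj_on_def using stab_mat_inj by (auto simp: isometries_def)
  show "(\<lambda>(h, w, c). stab_mat m J h w c) ` (isometries m J \<times> carrier_vec m \<times> UNIV) = stabiliser m J"
    using stab_mat_in_stabiliser stab_mat_surj by (fastforce simp: image_iff)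
qed

end

section \<open>Fixed vectors in the stabiliser\<close>

context
  fixes J h :: "'a::{finite,field} mat" and m and w :: "'a vec"
  assumes alt: "alt_form m J" and h: "h \<in> isometries m J" and w: "w \<in> carrier_vec m"
begin

private lemmas Jc = alt_form_carrier[OF alt]
private lemmas bil_lin = bil_add_left[OF Jc] bil_add_right[OF Jc] bil_smult_left[OF Jc] bil_smult_right[OF Jc]

private lemma hc: "h \<in> carrier_mat m m"
  using h by (simp add: isometries_def)

text \<open>The first coordinate of a fixed vector is unconstrained, since the first basis vector is
  itself fixed; this accounts for the factor q.\<close>

private lemma card_fixed_stab_mat_eq:
  "card (fixed_vectors (stab_mat m J h w c)) =
     CARD('a) * card {(b, u). u \<in> carrier_vec m \<and> c * b + bil J w (h *\<^sub>v u) = 0 \<and> b \<cdot>\<^sub>v w + h *\<^sub>v u = u}"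
    (is "_ = _ * card ?S")
proof -
  have "bij_betw (\<lambda>(a, b, u). vCons a (vCons b u)) (UNIV \<times> ?S) (fixed_vectors (stab_mat m J h w c))"
    unfolding bij_betw_def
  proof
    show "inj_on (\<lambda>(a, b, u). vCons a (vCons b u)) (UNIV \<times> ?S)" by (auto simp: inj_on_def)
    show "(\<lambda>(a, b, u). vCons a (vCons b u)) ` (UNIV \<times> ?S) = fixed_vectors (stab_mat m J h w c)"
      (is "?l = ?r")
    proof
      show "?l \<subseteq> ?r"
        using hc w
        by (auto simp: fixed_vectors_carrier[OF stab_mat_carrier[OF alt]] stab_mat_mult_vec[OF alt] add.assoc)
      show "?r \<subseteq> ?l"
      proof
        fix x assume "x \<in> ?r"
        then have x: "x \<in> carrier_vec (Suc (Suc m))" "stab_mat m J h w c *\<^sub>v x = x"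
          by (auto simp: fixed_vectors_carrier[OF stab_mat_carrier[OF alt]])
        obtain a b u where abu: "x = vCons a (vCons b u)" "u \<in> carrier_vec m"
          using x(1) by (rule carrier_vec_Suc2E)
        have "(b, u) \<in> ?S"
          using x(2) abu hc w by (simp add: stab_mat_mult_vec[OF alt] add.assoc)
        then show "x \<in> ?l" unfolding abu(1) by (intro image_eqI[of _ _ "(a, b, u)"]) auto
      qed
    qed
  qed
  from bij_betw_same_card[OF this] show ?thesis by (simp add: card_cartesian_product)
qed

text \<open>A fixed vector with second coordinate b satisfies b w = u - h u, so b = 0 because w is
  not in the image. What remains is the condition \<open>bil J w u = 0\<close> on the fixed vectors
  u of h. It is nontrivial, since the image is the whole orthogonal complement of the fixed space,
  so it costs a factor q, which the free first coordinate gives back.\<close>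

lemma card_fixed_stab_mat_generic:
  assumes nI: "w \<notin> (\<lambda>x. x - h *\<^sub>v x) ` carrier_vec m"
  shows "card (fixed_vectors (stab_mat m J h w c)) = card (fixed_vectors h)"
proof -
  obtain u0 where u0: "u0 \<in> fixed_vectors h" "bil J w u0 \<noteq> 0"
    using nI w perp_fixed_vectors(1)[OF alt h] by blast
  have b0: "b = 0" if "u \<in> carrier_vec m" "b \<cdot>\<^sub>v w + h *\<^sub>v u = u" for b u
  proof (rule ccontr)
    assume b: "b \<noteq> 0"
    let ?x = "inverse b \<cdot>\<^sub>v u"
    have "w = inverse b \<cdot>\<^sub>v ((b \<cdot>\<^sub>v w + h *\<^sub>v u) - h *\<^sub>v u)"
      using b w hc that(1) by (auto simp: vec_eq_iff)
    also have "\<dots> = ?x - h *\<^sub>v ?x"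
      unfolding that(2) mult_mat_vec[OF hc that(1)] using hc that(1) by (auto simp: vec_eq_iff algebra_simps)
    finally show False using nI that(1) by auto
  qed
  have "{(b, u). u \<in> carrier_vec m \<and> c * b + bil J w (h *\<^sub>v u) = 0 \<and> b \<cdot>\<^sub>v w + h *\<^sub>v u = u}
      = Pair 0 ` {u \<in> fixed_vectors h. bil J w u = 0}" (is "?S = ?R")
  proof
    show "?S \<subseteq> ?R"
    proof clarify
      fix b u assume u: "u \<in> carrier_vec m" "c * b + bil J w (h *\<^sub>v u) = 0" "b \<cdot>\<^sub>v w + h *\<^sub>v u = u"
      have b: "b = 0" using b0 u by blast
      have hu: "h *\<^sub>v u = u" using u(3) u(1) w hc by (simp add: b zero_smult_vec)
      show "(b, u) \<in> ?R" using u hu b by (simp add: fixed_vectors_carrier[OF hc])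
    qed
    show "?R \<subseteq> ?S" using w by (auto simp: fixed_vectors_carrier[OF hc] zero_smult_vec)
  qed
  then have "card (fixed_vectors (stab_mat m J h w c)) = CARD('a) * card {u \<in> fixed_vectors h. bil J w u = 0}"
    by (simp add: card_fixed_stab_mat_eq card_image inj_on_def)
  also have "\<dots> = card (fixed_vectors h)"
    by (rule card_kernel_functional[symmetric, where w = u0, OF subsp_fixed_vectors[OF hc]])
      (use u0 w in \<open>auto simp: fixed_vectors_carrier[OF hc] bil_lin\<close>)
  finally show ?thesis .
qed

text \<open>Replacing u by b x0 + u turns the vector equation into h u = u. The scalar equation then
  becomes b (c + \<open>bil J w (h x0)\<close>) = 0, because w is orthogonal to the fixed vectors of
  h: either b is arbitrary or b = 0.\<close>

lemma card_fixed_stab_mat_special: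
  assumes x0: "x0 \<in> carrier_vec m" "w = x0 - h *\<^sub>v x0"
  shows "card (fixed_vectors (stab_mat m J h w c)) =
     CARD('a) * ((if c + bil J w (h *\<^sub>v x0) = 0 then CARD('a) else 1) * card (fixed_vectors h))"
proof -
  let ?B = "{b. b * (c + bil J w (h *\<^sub>v x0)) = 0}"
  let ?S = "{(b, u). u \<in> carrier_vec m \<and> c * b + bil J w (h *\<^sub>v u) = 0 \<and> b \<cdot>\<^sub>v w + h *\<^sub>v u = u}"
  have orth: "bil J w u = 0" if "u \<in> fixed_vectors h" for u
    using that x0 perp_fixed_vectors(1)[OF alt h] by blast
  have hx0: "h *\<^sub>v x0 \<in> carrier_vec m" using hc x0 by simp
  have hu: "h *\<^sub>v (b \<cdot>\<^sub>v x0 + u) = b \<cdot>\<^sub>v (h *\<^sub>v x0) + h *\<^sub>v u" if "u \<in> carrier_vec m" for b u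
    using that x0 by (simp add: mult_add_distrib_mat_vec[OF hc] mult_mat_vec[OF hc])
  have cancel: "(- b) \<cdot>\<^sub>v x0 + (b \<cdot>\<^sub>v x0 + u) = u" "b \<cdot>\<^sub>v x0 + ((- b) \<cdot>\<^sub>v x0 + u) = u"
    if "u \<in> carrier_vec m" for b u
    using that x0(1) by (auto intro!: eq_vecI)
  have shift: "b \<cdot>\<^sub>v (x0 - y) + (b \<cdot>\<^sub>v y + u) = b \<cdot>\<^sub>v x0 + u"
      "(- b) \<cdot>\<^sub>v y + u = (- b) \<cdot>\<^sub>v x0 + (b \<cdot>\<^sub>v (x0 - y) + u)"
    if "y \<in> carrier_vec m" "u \<in> carrier_vec m" for b y u
    using that x0(1) by (auto intro!: eq_vecI simp: algebra_simps)
  have "bij_betw (\<lambda>(b, u). (b, b \<cdot>\<^sub>v x0 + u)) (?B \<times> fixed_vectors h) ?S"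
  proof (rule bij_betw_byWitness[where f' = "\<lambda>(b, u). (b, (- b) \<cdot>\<^sub>v x0 + u)"])
    show "\<forall>p\<in>?B \<times> fixed_vectors h.
        (case (case p of (b, u) \<Rightarrow> (b, b \<cdot>\<^sub>v x0 + u)) of (b, u) \<Rightarrow> (b, (- b) \<cdot>\<^sub>v x0 + u)) = p"
      by (auto simp: fixed_vectors_carrier[OF hc] cancel)
    show "\<forall>p\<in>?S. (case (case p of (b, u) \<Rightarrow> (b, (- b) \<cdot>\<^sub>v x0 + u)) of (b, u) \<Rightarrow> (b, b \<cdot>\<^sub>v x0 + u)) = p"
      by (auto simp: cancel)
    show "(\<lambda>(b, u). (b, b \<cdot>\<^sub>v x0 + u)) ` (?B \<times> fixed_vectors h) \<subseteq> ?S"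
    proof (clarify, intro conjI)
      fix b u assume b: "b * (c + bil J w (h *\<^sub>v x0)) = 0" and u: "u \<in> fixed_vectors h"
      have uc: "u \<in> carrier_vec m" "h *\<^sub>v u = u" using u by (auto simp: fixed_vectors_carrier[OF hc])
      show "b \<cdot>\<^sub>v x0 + u \<in> carrier_vec m" using uc x0 by simp
      show "c * b + bil J w (h *\<^sub>v (b \<cdot>\<^sub>v x0 + u)) = 0"
        using b uc hx0 w orth[OF u] by (simp add: hu bil_lin algebra_simps)
      have "b \<cdot>\<^sub>v w + (b \<cdot>\<^sub>v (h *\<^sub>v x0) + u) = b \<cdot>\<^sub>v x0 + u"
        unfolding x0(2) by (rule shift(1)[OF hx0 uc(1)])
      then show "b \<cdot>\<^sub>v w + h *\<^sub>v (b \<cdot>\<^sub>v x0 + u) = b \<cdot>\<^sub>v x0 + u" using uc by (simp add: hu)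
    qed
    show "(\<lambda>(b, u). (b, (- b) \<cdot>\<^sub>v x0 + u)) ` ?S \<subseteq> ?B \<times> fixed_vectors h"
    proof (rule image_subsetI)
      fix p assume "p \<in> ?S"
      then obtain b u where p: "p = (b, u)" and
        u: "u \<in> carrier_vec m" "c * b + bil J w (h *\<^sub>v u) = 0" "b \<cdot>\<^sub>v w + h *\<^sub>v u = u" by blast
      let ?v = "(- b) \<cdot>\<^sub>v x0 + u"
      have hv: "h *\<^sub>v u \<in> carrier_vec m" using hc u by simp
      have "(- b) \<cdot>\<^sub>v (h *\<^sub>v x0) + h *\<^sub>v u = (- b) \<cdot>\<^sub>v x0 + (b \<cdot>\<^sub>v w + h *\<^sub>v u)"
        unfolding x0(2) by (rule shift(2)[OF hx0 hv])
      then have v: "?v \<in> fixed_vectors h"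
        using u x0 by (simp add: fixed_vectors_carrier[OF hc] hu)
      have "bil J w (h *\<^sub>v ?v) = 0" using orth[OF v] v by (simp add: fixed_vectors_carrier[OF hc])
      then have "bil J w (h *\<^sub>v u) = b * bil J w (h *\<^sub>v x0)"
        using w hx0 hv u by (simp add: hu bil_lin)
      then have "b * (c + bil J w (h *\<^sub>v x0)) = 0" using u(2) by (simp add: algebra_simps)
      with v show "(case p of (b, u) \<Rightarrow> (b, (- b) \<cdot>\<^sub>v x0 + u)) \<in> ?B \<times> fixed_vectors h"
        unfolding p by simp
    qed
  qed
  from bij_betw_same_card[OF this] have "card ?S = card ?B * card (fixed_vectors h)"
    by (simp add: card_cartesian_product)
  moreover have "card ?B = (if c + bil J w (h *\<^sub>v x0) = 0 then CARD('a) else 1)" by simp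
  ultimately show ?thesis unfolding card_fixed_stab_mat_eq by simp
qed

end

text \<open>The mean of \<open>\<phi>\<close> over the numbers of fixed vectors of the elements of the stabiliser lying
  over an \<open>h\<close> with \<open>N\<close> fixed vectors.\<close>

definition fix_step :: "real \<Rightarrow> (real \<Rightarrow> real) \<Rightarrow> real \<Rightarrow> real" where
  "fix_step q \<phi> N = (1 - 1 / N) * \<phi> N + 1 / N * (1 / q * \<phi> (q\<^sup>2 * N) + (1 - 1 / q) * \<phi> (q * N))"

lemma sum_stab_mat:
  fixes J h :: "'a::{finite,field} mat"
  assumes alt: "alt_form m J" and h: "h \<in> isometries m J"
  shows "(\<Sum>w\<in>carrier_vec m. \<Sum>c\<in>UNIV. \<phi> (real (card (fixed_vectors (stab_mat m J h w c)))))
     = real CARD('a) ^ Suc m * fix_step (real CARD('a)) \<phi> (real (card (fixed_vectors h)))"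
proof -
  let ?q = "real CARD('a)" and ?N = "real (card (fixed_vectors h))"
  let ?I = "(\<lambda>x. x - h *\<^sub>v x) ` carrier_vec m"
  have hc: "h \<in> carrier_mat m m" using h by (simp add: isometries_def)
  have Ic: "?I \<subseteq> carrier_vec m" using hc by auto
  note fin = finite_carrier_vec_field[of m, where 'a = 'a]
  have q: "?q \<ge> 2" using CARD_field_ge_2[where 'a = 'a] by simp
  have cI: "real (card ?I) * ?N = ?q ^ m"
    using perp_fixed_vectors(2)[OF alt h] by (metis of_nat_mult of_nat_power)
  have N: "?N > 0"
    using cI q by (cases "card (fixed_vectors h) = 0") auto
  have alg: "(X - X / n) * (r * a) + X / n * (b + (r - 1) * c)
      = r * X * ((1 - 1 / n) * a + 1 / n * (1 / r * b + (1 - 1 / r) * c))"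
    if "n \<noteq> 0" "r \<noteq> 0" for X n r a b c :: real
  proof -
    have "b + (r - 1) * c = r * (1 / r * b + (1 - 1 / r) * c)" using that by (simp add: algebra_simps)
    then show ?thesis using that by (simp add: field_simps)
  qed
  have special: "(\<Sum>c\<in>UNIV. \<phi> (real (card (fixed_vectors (stab_mat m J h w c)))))
      = \<phi> (?q\<^sup>2 * ?N) + (?q - 1) * \<phi> (?q * ?N)" if w: "w \<in> ?I" for w
  proof -
    obtain x0 where x0: "x0 \<in> carrier_vec m" "w = x0 - h *\<^sub>v x0" using w by blast
    have wc: "w \<in> carrier_vec m" using w Ic by blast
    \<comment> \<open>The one value of c for which the second coordinate of a fixed vector is
      free.\<close>
    define c0 where "c0 = - bil J w (h *\<^sub>v x0)"
    have "(\<Sum>c\<in>UNIV. \<phi> (real (card (fixed_vectors (stab_mat m J h w c)))))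
       = (\<Sum>c\<in>UNIV. if c = c0 then \<phi> (?q\<^sup>2 * ?N) else \<phi> (?q * ?N))"
      by (intro sum.cong refl)
        (auto simp: card_fixed_stab_mat_special[OF alt h wc x0] c0_def eq_neg_iff_add_eq_0
          power2_eq_square mult.assoc)
    also have "\<dots> = \<phi> (?q\<^sup>2 * ?N) + (\<Sum>c\<in>UNIV - {c0}. if c = c0 then \<phi> (?q\<^sup>2 * ?N) else \<phi> (?q * ?N))"
      by (subst sum.remove[of _ c0]) auto
    also have "(\<Sum>c\<in>UNIV - {c0}. if c = c0 then \<phi> (?q\<^sup>2 * ?N) else \<phi> (?q * ?N))
        = (\<Sum>c\<in>UNIV - {c0}. \<phi> (?q * ?N))" by (intro sum.cong) auto
    also have "\<dots> = (?q - 1) * \<phi> (?q * ?N)"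
      using q by (simp add: card_Diff_singleton of_nat_diff)
    finally show ?thesis .
  qed
  have generic: "(\<Sum>c\<in>UNIV. \<phi> (real (card (fixed_vectors (stab_mat m J h w c))))) = ?q * \<phi> ?N"
    if "w \<in> carrier_vec m - ?I" for w
    using that by (simp add: card_fixed_stab_mat_generic[OF alt h])
  have "(\<Sum>w\<in>carrier_vec m. \<Sum>c\<in>UNIV. \<phi> (real (card (fixed_vectors (stab_mat m J h w c)))))
     = (\<Sum>w\<in>carrier_vec m - ?I. ?q * \<phi> ?N) + (\<Sum>w\<in>?I. \<phi> (?q\<^sup>2 * ?N) + (?q - 1) * \<phi> (?q * ?N))"
    unfolding sum.subset_diff[OF Ic fin] using special generic by (intro arg_cong2[where f = "(+)"] sum.cong) auto
  also have "\<dots> = (?q ^ m - card ?I) * (?q * \<phi> ?N) + card ?I * (\<phi> (?q\<^sup>2 * ?N) + (?q - 1) * \<phi> (?q * ?N))"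
  proof -
    have "card ?I \<le> CARD('a) ^ m" using card_mono[OF fin Ic] by (simp add: card_carrier_vec_field)
    moreover have "card (carrier_vec m - ?I) = CARD('a) ^ m - card ?I"
      using Ic fin finite_subset[OF Ic fin] by (simp add: card_Diff_subset card_carrier_vec_field)
    ultimately show ?thesis by (simp only: sum_constant of_nat_diff of_nat_power)
  qed
  \<comment> \<open>The exceptional w make up a share 1 / N of all vectors, which is the weight 1 /
    N in \<open>fix_step\<close>.\<close>
  also have "real (card ?I) = ?q ^ m / ?N" by (rule eq_divide_imp) (use cI N in auto)
  also have "(?q ^ m - ?q ^ m / ?N) * (?q * \<phi> ?N) + ?q ^ m / ?N * (\<phi> (?q\<^sup>2 * ?N) + (?q - 1) * \<phi> (?q * ?N))
     = ?q ^ Suc m * fix_step ?q \<phi> ?N"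
    unfolding fix_step_def power_Suc by (rule alg) (use q N in auto)
  finally show ?thesis .
qed

lemma finite_isometries: "finite (isometries n (J :: 'a::{finite,field} mat))"
proof (rule finite_subset)
  show "isometries n J \<subseteq> (\<lambda>f. mat n n f) ` (({..<n} \<times> {..<n}) \<rightarrow>\<^sub>E UNIV)"
  proof
    fix A assume "A \<in> isometries n J"
    then have "A = mat n n (restrict (\<lambda>ij. A $$ ij) ({..<n} \<times> {..<n}))"
      by (auto simp: isometries_def intro!: eq_matI)
    then show "A \<in> (\<lambda>f. mat n n f) ` (({..<n} \<times> {..<n}) \<rightarrow>\<^sub>E UNIV)" by auto
  qed
qed (intro finite_imageI finite_PiE, auto)

lemma sum_stabiliser:
  fixes J :: "'a::{finite,field} mat"
  assumes alt: "alt_form m J"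
  shows "(\<Sum>g\<in>stabiliser m J. \<phi> (real (card (fixed_vectors g))))
     = real CARD('a) ^ Suc m * (\<Sum>h\<in>isometries m J. fix_step (real CARD('a)) \<phi> (real (card (fixed_vectors h))))"
proof -
  have "(\<Sum>g\<in>stabiliser m J. \<phi> (real (card (fixed_vectors g))))
     = (\<Sum>(h, w, c)\<in>isometries m J \<times> carrier_vec m \<times> UNIV. \<phi> (real (card (fixed_vectors (stab_mat m J h w c)))))"
    using sum.reindex_bij_betw[OF bij_betw_stab_mat[OF alt], of "\<lambda>g. \<phi> (real (card (fixed_vectors g)))"]
    by (simp add: case_prod_unfold)
  also have "\<dots> = (\<Sum>h\<in>isometries m J. \<Sum>w\<in>carrier_vec m. \<Sum>c\<in>UNIV. \<phi> (real (card (fixed_vectors (stab_mat m J h w c)))))"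
    by (simp add: sum.cartesian_product)
  also have "\<dots> = (\<Sum>h\<in>isometries m J. real CARD('a) ^ Suc m * fix_step (real CARD('a)) \<phi> (real (card (fixed_vectors h))))"
    by (intro sum.cong refl sum_stab_mat[OF alt])
  finally show ?thesis by (simp add: sum_distrib_left)
qed

lemma card_fixed_vectors_conj:
  fixes A P Q :: "'a::{finite,field} mat"
  assumes A: "A \<in> carrier_mat n n" and P: "P \<in> carrier_mat n n" and Q: "Q \<in> carrier_mat n n"
    and PQ: "P * Q = 1\<^sub>m n" "Q * P = 1\<^sub>m n"
  shows "card (fixed_vectors (Q * A * P)) = card (fixed_vectors A)"
proof -
  have QP: "Q *\<^sub>v (P *\<^sub>v x) = x" "P *\<^sub>v (Q *\<^sub>v x) = x" if "x \<in> carrier_vec n" for x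
    using assoc_mult_mat_vec[OF P Q that] assoc_mult_mat_vec[OF Q P that] that PQ by auto
  have QAP: "(Q * A * P) *\<^sub>v x = Q *\<^sub>v (A *\<^sub>v (P *\<^sub>v x))" if "x \<in> carrier_vec n" for x
    using A P Q that by (simp add: assoc_mult_mat_vec[of _ n n _ n])
  have fx: "fixed_vectors (Q * A * P) = {v \<in> carrier_vec n. (Q * A * P) *\<^sub>v v = v}"
    by (rule fixed_vectors_carrier) (use A P Q in auto)
  have "bij_betw (\<lambda>v. P *\<^sub>v v) (fixed_vectors (Q * A * P)) (fixed_vectors A)"
  proof (rule bij_betw_byWitness[where f' = "\<lambda>v. Q *\<^sub>v v"])
    show "(\<lambda>v. P *\<^sub>v v) ` fixed_vectors (Q * A * P) \<subseteq> fixed_vectors A"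
    proof (intro image_subsetI)
      fix v assume "v \<in> fixed_vectors (Q * A * P)"
      then have v: "v \<in> carrier_vec n" "Q *\<^sub>v (A *\<^sub>v (P *\<^sub>v v)) = v" by (auto simp: fx QAP)
      have "A *\<^sub>v (P *\<^sub>v v) = P *\<^sub>v (Q *\<^sub>v (A *\<^sub>v (P *\<^sub>v v)))" using v(1) A P by (simp add: QP)
      then show "P *\<^sub>v v \<in> fixed_vectors A" unfolding v(2) using v(1) P A by (simp add: fixed_vectors_carrier)
    qed
    show "(\<lambda>v. Q *\<^sub>v v) ` fixed_vectors A \<subseteq> fixed_vectors (Q * A * P)"
      using A Q by (auto simp: fx fixed_vectors_carrier QAP QP)
  qed (use A in \<open>auto simp: fx fixed_vectors_carrier QP\<close>)
  then show ?thesis by (rule bij_betw_same_card)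
qed

section \<open>Averages over the symplectic group\<close>

text \<open>Conjugation preserves the number of fixed vectors. The lemma is used in two ways: with u
  = 0 it compares the groups of two congruent forms, and with P an isometry of J it compares the
  stabilisers of two vectors in one group.\<close>

lemma sum_isometries_conj:
  fixes J :: "'a::{finite,field} mat"
  assumes J: "J \<in> carrier_mat n n" and P: "injective_mat n P" and u: "u \<in> carrier_vec n"
  shows "(\<Sum>A | A \<in> isometries n J \<and> A *\<^sub>v (P *\<^sub>v u) = P *\<^sub>v u. \<phi> (real (card (fixed_vectors A))))
    = (\<Sum>B | B \<in> isometries n (transpose_mat P * J * P) \<and> B *\<^sub>v u = u. \<phi> (real (card (fixed_vectors B))))"
proof -
  let ?J' = "transpose_mat P * J * P"
  obtain Q where Q: "injective_mat n Q" "P * Q = 1\<^sub>m n" "Q * P = 1\<^sub>m n"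
    using injective_mat_obtain_inverse[OF P] .
  note Pc = injective_mat_carrier[OF P] and Qc = injective_mat_carrier[OF Q(1)]
  have J': "?J' \<in> carrier_mat n n" using J Pc by auto
  have QJ': "transpose_mat Q * ?J' * Q = J"
    using congruence_comp[OF J Pc Qc] J Q(2) by simp
  have QP: "Q *\<^sub>v (P *\<^sub>v x) = x" "P *\<^sub>v (Q *\<^sub>v x) = x" if "x \<in> carrier_vec n" for x
    using assoc_mult_mat_vec[OF Pc Qc that] assoc_mult_mat_vec[OF Qc Pc that] that Q by auto
  have app: "(X * A * Y) *\<^sub>v x = X *\<^sub>v (A *\<^sub>v (Y *\<^sub>v x))"
    if "X \<in> carrier_mat n n" "A \<in> carrier_mat n n" "Y \<in> carrier_mat n n" "x \<in> carrier_vec n"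
    for X A Y :: "'a mat" and x
    using that by (simp add: assoc_mult_mat_vec[of _ n n _ n])
  have cancel: "X * (Y * A * X) * Y = A"
    if X: "X \<in> carrier_mat n n" "Y \<in> carrier_mat n n" and XY: "X * Y = 1\<^sub>m n" and A: "A \<in> carrier_mat n n"
    for X Y A :: "'a mat"
  proof -
    have "X * (Y * A * X) * Y = (X * Y) * (A * (X * Y))"
      using X A by (simp add: assoc_mult_mat[of _ n n _ n _ n])
    then show ?thesis using A by (simp add: XY)
  qed
  show ?thesis
  proof (rule sum.reindex_bij_witness[where i = "\<lambda>B. P * B * Q" and j = "\<lambda>A. Q * A * P"])
    fix A assume "A \<in> {A. A \<in> isometries n J \<and> A *\<^sub>v (P *\<^sub>v u) = P *\<^sub>v u}"
    then have A: "A \<in> isometries n J" "A *\<^sub>v (P *\<^sub>v u) = P *\<^sub>v u" by auto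
    have Ac: "A \<in> carrier_mat n n" using A by (simp add: isometries_def)
    show "P * (Q * A * P) * Q = A" by (rule cancel[OF Pc Qc Q(2) Ac])
    have "(Q * A * P) *\<^sub>v u = u" using A(2) by (simp add: app[OF Qc Ac Pc u] QP[OF u])
    then show "Q * A * P \<in> {B. B \<in> isometries n ?J' \<and> B *\<^sub>v u = u}"
      using isometries_conj[OF J Pc Qc Q(2) A(1)] by simp
    show "\<phi> (real (card (fixed_vectors (Q * A * P)))) = \<phi> (real (card (fixed_vectors A)))"
      using card_fixed_vectors_conj[OF Ac Pc Qc Q(2,3)] by simp
  next
    fix B assume "B \<in> {B. B \<in> isometries n ?J' \<and> B *\<^sub>v u = u}"
    then have B: "B \<in> isometries n ?J'" "B *\<^sub>v u = u" by auto
    have Bc: "B \<in> carrier_mat n n" using B by (simp add: isometries_def)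
    show "Q * (P * B * Q) * P = B" by (rule cancel[OF Qc Pc Q(3) Bc])
    have "(P * B * Q) *\<^sub>v (P *\<^sub>v u) = P *\<^sub>v u"
      using B(2) u Pc by (simp add: app[OF Pc Bc Qc] QP[OF u])
    then show "P * B * Q \<in> {A. A \<in> isometries n J \<and> A *\<^sub>v (P *\<^sub>v u) = P *\<^sub>v u}"
      using isometries_conj[OF J' Qc Pc Q(3) B(1)] by (simp add: QJ')
  qed
qed

lemma sum_isometries_congruent:
  fixes J :: "'a::{finite,field} mat"
  assumes J: "J \<in> carrier_mat n n" and P: "injective_mat n P"
  shows "(\<Sum>A\<in>isometries n J. \<phi> (real (card (fixed_vectors A))))
    = (\<Sum>B\<in>isometries n (transpose_mat P * J * P). \<phi> (real (card (fixed_vectors B))))"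
proof -
  have "{A. A \<in> isometries n K \<and> A *\<^sub>v 0\<^sub>v n = 0\<^sub>v n} = isometries n K" for K :: "'a mat"
    by (auto simp: isometries_def)
  then show ?thesis
    using sum_isometries_conj[OF J P, of "0\<^sub>v n" \<phi>] injective_mat_carrier[OF P] by simp
qed

text \<open>Counting pairs of an isometry and a nonzero fixed vector; transitivity on nonzero vectors
  makes every vector contribute the same amount.\<close>

lemma sum_nonzero_fixed_vectors:
  fixes J :: "'a::{finite,field} mat"
  assumes J: "J \<in> carrier_mat n n" and e: "e \<in> carrier_vec n"
    and trans: "\<And>v. v \<in> carrier_vec n \<Longrightarrow> v \<noteq> 0\<^sub>v n \<Longrightarrow>
        \<exists>P\<in>isometries n J. injective_mat n P \<and> P *\<^sub>v e = v"
  shows "(\<Sum>g\<in>isometries n J. (real (card (fixed_vectors g)) - 1) * \<phi> (real (card (fixed_vectors g))))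
    = (real CARD('a) ^ n - 1) * (\<Sum>g | g \<in> isometries n J \<and> g *\<^sub>v e = e. \<phi> (real (card (fixed_vectors g))))"
proof -
  let ?V = "carrier_vec n - {0\<^sub>v n} :: 'a vec set" and ?G = "isometries n J"
  let ?f = "\<lambda>g. \<phi> (real (card (fixed_vectors g)))"
  note fin = finite_carrier_vec_field[of n, where 'a = 'a] finite_isometries[of n J]
  have "(real (card (fixed_vectors g)) - 1) * ?f g = (\<Sum>v\<in>?V. if g *\<^sub>v v = v then ?f g else 0)"
    if "g \<in> ?G" for g
  proof -
    have gc: "g \<in> carrier_mat n n" using that by (simp add: isometries_def)
    have "0\<^sub>v n \<in> fixed_vectors g" using gc by (simp add: fixed_vectors_carrier)
    then have "card (fixed_vectors g) = Suc (card (fixed_vectors g - {0\<^sub>v n}))"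
      using card.remove[OF finite_fixed_vectors] by blast
    moreover have "fixed_vectors g - {0\<^sub>v n} = {v \<in> ?V. g *\<^sub>v v = v}"
      using gc by (auto simp: fixed_vectors_carrier)
    ultimately have "real (card (fixed_vectors g)) - 1 = real (card {v \<in> ?V. g *\<^sub>v v = v})" by simp
    then show ?thesis using fin by (simp flip: sum.inter_filter)
  qed
  then have "(\<Sum>g\<in>?G. (real (card (fixed_vectors g)) - 1) * ?f g)
      = (\<Sum>g\<in>?G. \<Sum>v\<in>?V. if g *\<^sub>v v = v then ?f g else 0)"
    by (intro sum.cong refl)
  also have "\<dots> = (\<Sum>v\<in>?V. \<Sum>g\<in>?G. if g *\<^sub>v v = v then ?f g else 0)" by (rule sum.swap)
  also have "\<dots> = (\<Sum>v\<in>?V. \<Sum>g | g \<in> ?G \<and> g *\<^sub>v e = e. ?f g)"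
  proof (rule sum.cong[OF refl])
    fix v assume "v \<in> ?V"
    then obtain P where P: "P \<in> ?G" "injective_mat n P" "P *\<^sub>v e = v" using trans by blast
    have "(\<Sum>g\<in>?G. if g *\<^sub>v v = v then ?f g else 0) = (\<Sum>g | g \<in> ?G \<and> g *\<^sub>v v = v. ?f g)"
      using fin by (simp add: sum.inter_filter)
    \<comment> \<open>As \<open>P\<close> preserves J, conjugation by it maps the stabiliser of v
      onto that of e inside the same group.\<close>
    also have "\<dots> = (\<Sum>g | g \<in> ?G \<and> g *\<^sub>v e = e. ?f g)"
      using sum_isometries_conj[OF J P(2) e, of \<phi>] P(1) by (simp add: P(3) isometries_def)
    finally show "(\<Sum>g\<in>?G. if g *\<^sub>v v = v then ?f g else 0) = (\<Sum>g | g \<in> ?G \<and> g *\<^sub>v e = e. ?f g)" .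
  qed
  also have "\<dots> = (real CARD('a) ^ n - 1) * (\<Sum>g | g \<in> ?G \<and> g *\<^sub>v e = e. ?f g)"
  proof -
    have "card (carrier_vec n :: 'a vec set) = Suc (card ?V)"
      using card.remove[OF fin(1), of "0\<^sub>v n"] by simp
    then have "real (card ?V) = real CARD('a) ^ n - 1"
      by (simp add: card_carrier_vec_field flip: of_nat_power)
    then show ?thesis by simp
  qed
  finally show ?thesis .
qed

text \<open>Orbit-stabiliser: injectivity keeps the orbit of e among the nonzero vectors,
  transitivity makes it all of them, and each fibre of g \<mapsto> g e is a left coset of the
  stabiliser.\<close>

lemma card_isometries_orbit:
  fixes J :: "'a::{finite,field} mat"
  assumes alt: "alt_form n J" and e: "e \<in> carrier_vec n" "e \<noteq> 0\<^sub>v n"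
    and trans: "\<And>v. v \<in> carrier_vec n \<Longrightarrow> v \<noteq> 0\<^sub>v n \<Longrightarrow>
        \<exists>P\<in>isometries n J. injective_mat n P \<and> P *\<^sub>v e = v"
  shows "real (card (isometries n J)) =
    (real CARD('a) ^ n - 1) * real (card {g \<in> isometries n J. g *\<^sub>v e = e})"
proof -
  let ?V = "carrier_vec n - {0\<^sub>v n} :: 'a vec set" and ?G = "isometries n J"
  note J = alt_form_carrier[OF alt]
  note fin = finite_carrier_vec_field[of n, where 'a = 'a] finite_isometries[of n J]
  have ge: "(\<lambda>g. g *\<^sub>v e) ` ?G \<subseteq> ?V"
  proof (rule image_subsetI)
    fix g assume "g \<in> ?G"
    then have "injective_mat n g" by (rule isometries_injective[OF alt])
    then show "g *\<^sub>v e \<in> ?V" using e by (auto simp: injective_mat_def)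
  qed
  have fibre: "card {g \<in> ?G. g *\<^sub>v e = v} = card {g \<in> ?G. g *\<^sub>v e = e}" if v: "v \<in> ?V" for v
  proof -
    obtain P where P: "P \<in> ?G" "injective_mat n P" "P *\<^sub>v e = v" using trans v by blast
    obtain Q where Q: "injective_mat n Q" "P * Q = 1\<^sub>m n" "Q * P = 1\<^sub>m n"
      using injective_mat_obtain_inverse[OF P(2)] .
    note c = injective_mat_carrier[OF P(2)] injective_mat_carrier[OF Q(1)]
    \<comment> \<open>Congruence by \<open>P\<close> leaves J unchanged, hence so does congruence by
      its inverse \<open>Q\<close>.\<close>
    have QG: "Q \<in> ?G"
    proof -
      have one: "1\<^sub>m n \<in> ?G" using J by (simp add: isometries_def)
      have "Q * 1\<^sub>m n * P \<in> isometries n (transpose_mat P * J * P)" and PJ: "transpose_mat P * J * P = J"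
        using isometries_conj[OF J c Q(2) one] P(1) by (auto simp: isometries_def)
      have "transpose_mat Q * J * Q = transpose_mat Q * (transpose_mat P * J * P) * Q" by (simp add: PJ)
      also have "\<dots> = J" using congruence_comp[OF J c] Q(2) J by simp
      finally show ?thesis using c by (simp add: isometries_def)
    qed
    have cancel: "P * (Q * g) = g" "Q * (P * g) = g" if "g \<in> carrier_mat n n" for g
      using that c Q by (simp_all flip: assoc_mult_mat[of _ n n _ n _ n])
    have "bij_betw (\<lambda>g. P * g) {g \<in> ?G. g *\<^sub>v e = e} {g \<in> ?G. g *\<^sub>v e = v}"
    proof (rule bij_betw_byWitness[where f' = "\<lambda>g. Q * g"])
      show "(\<lambda>g. P * g) ` {g \<in> ?G. g *\<^sub>v e = e} \<subseteq> {g \<in> ?G. g *\<^sub>v e = v}"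
        using isometries_mult[OF J P(1)] c e P(3)
        by (auto simp: isometries_def assoc_mult_mat_vec[of _ n n _ n])
      have "Q *\<^sub>v v = e"
        using assoc_mult_mat_vec[OF c(2,1) e(1)] e Q(3) P(3) by simp
      then show "(\<lambda>g. Q * g) ` {g \<in> ?G. g *\<^sub>v e = v} \<subseteq> {g \<in> ?G. g *\<^sub>v e = e}"
        using isometries_mult[OF J QG] c e
        by (auto simp: isometries_def assoc_mult_mat_vec[of _ n n _ n])
    qed (auto simp: isometries_def cancel)
    then show ?thesis by (rule bij_betw_same_card[symmetric])
  qed
  have "card ?G = (\<Sum>v\<in>?V. card {g \<in> ?G. g *\<^sub>v e = v})"
    using sum.group[OF fin(2) _ ge, of "\<lambda>_. 1::nat"] fin(1) by simp
  also have "\<dots> = card ?V * card {g \<in> ?G. g *\<^sub>v e = e}" using fibre by simp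
  finally have "real (card ?G) = real (card ?V) * real (card {g \<in> ?G. g *\<^sub>v e = e})" by simp
  moreover have "card (carrier_vec n :: 'a vec set) = Suc (card ?V)"
    using card.remove[OF fin(1), of "0\<^sub>v n"] by simp
  then have "real (card ?V) = real CARD('a) ^ n - 1"
    by (simp add: card_carrier_vec_field flip: of_nat_power)
  ultimately show ?thesis by simp
qed

section \<open>Mean values over the symplectic group\<close>

lemma alt_form_symplectic: "alt_form (2 * n) (symplectic_form_mat n :: 'a::field mat)"
proof -
  let ?S = "symplectic_form_mat n :: 'a mat"
  have S: "?S \<in> carrier_mat (2 * n) (2 * n)"
    by (simp add: symplectic_form_mat_def mult_2)
  have Sv: "?S *\<^sub>v (x @\<^sub>v y) = y @\<^sub>v (- x)" if "x \<in> carrier_vec n" "y \<in> carrier_vec n" for x y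
  proof -
    have "- 1\<^sub>m n *\<^sub>v x = - x" using that by (intro eq_vecI) (auto simp: scalar_prod_uminus_left)
    then show ?thesis
      using that unfolding symplectic_form_mat_def
      by (subst four_block_mat_mult_vec[of _ n n _ n _ n]) auto
  qed
  have split: "\<exists>x y. z = x @\<^sub>v y \<and> x \<in> carrier_vec n \<and> y \<in> carrier_vec n"
    if "z \<in> carrier_vec (2 * n)" for z :: "'a vec"
    using that vec_first_last_append[of z n n] by (metis mult_2 vec_first_carrier vec_last_carrier)
  show ?thesis
  proof (rule alt_formI[OF S])
    fix z :: "'a vec" assume z: "z \<in> carrier_vec (2 * n)"
    obtain x y where xy: "z = x @\<^sub>v y" "x \<in> carrier_vec n" "y \<in> carrier_vec n" using split[OF z] by blast
    show "bil ?S z z = 0"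
      unfolding bil_def xy(1) Sv[OF xy(2,3)] using xy(2,3)
      by (simp add: scalar_prod_append[of _ n _ n] comm_scalar_prod[of y n])
    assume o: "\<And>t. t \<in> carrier_vec (2 * n) \<Longrightarrow> bil ?S t z = 0"
    have "?S *\<^sub>v z = 0\<^sub>v (2 * n)"
      by (rule vec_eq_0I_scalar_prod) (use S z o in \<open>auto simp: bil_def\<close>)
    moreover have "0\<^sub>v (2 * n) = (0\<^sub>v n @\<^sub>v 0\<^sub>v n :: 'a vec)" by (auto simp: vec_eq_iff)
    ultimately have "y @\<^sub>v (- x) = 0\<^sub>v n @\<^sub>v 0\<^sub>v n" using xy by (simp add: Sv)
    then have "y = 0\<^sub>v n" "- x = 0\<^sub>v n" using xy append_vec_eq[of y n "0\<^sub>v n"] by auto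
    moreover from this(2) have "x = 0\<^sub>v n" using xy(2) by (auto simp: vec_eq_iff)
    ultimately show "z = 0\<^sub>v (2 * n)" unfolding xy(1) by (auto simp: vec_eq_iff)
  qed
qed

definition fix_mean :: "'a::{finite,field} itself \<Rightarrow> nat \<Rightarrow> (real \<Rightarrow> real) \<Rightarrow> real" where
  "fix_mean _ n \<phi> = (\<Sum>g\<in>(Sp n :: 'a mat set). \<phi> (real (card (fixed_vectors g)))) / card (Sp n :: 'a mat set)"

text \<open>A symplectic basis of the block form transports the sums to the isometries of
  \<open>hyp n\<close>; the constant function 1 transports the group order.\<close>

lemma fix_mean_hyp:
  "fix_mean TYPE('a::{finite,field}) n \<phi> =
     (\<Sum>g\<in>isometries (2 * n) (hyp n :: 'a mat). \<phi> (real (card (fixed_vectors g)))) /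
       card (isometries (2 * n) (hyp n :: 'a mat))"
  and alt_form_hyp: "alt_form (2 * n) (hyp n :: 'a mat)"
proof -
  note alt = alt_form_symplectic[of n, where 'a = 'a]
  have Sp: "Sp n = isometries (2 * n) (symplectic_form_mat n :: 'a mat)"
    by (simp add: Sp_def isometries_def)
  obtain P where P: "injective_mat (2 * n) P" "transpose_mat P * symplectic_form_mat n * P = (hyp n :: 'a mat)"
    using symplectic_basis(1)[OF alt] by blast
  show "alt_form (2 * n) (hyp n :: 'a mat)"
    using alt_form_congruence[OF alt P(1)] by (simp add: P(2))
  note c = sum_isometries_congruent[OF alt_form_carrier[OF alt] P(1), unfolded P(2) Sp[symmetric]]
  show "fix_mean TYPE('a) n \<phi> =
     (\<Sum>g\<in>isometries (2 * n) (hyp n :: 'a mat). \<phi> (real (card (fixed_vectors g)))) /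
       card (isometries (2 * n) (hyp n :: 'a mat))"
    unfolding fix_mean_def using c[of \<phi>] c[of "\<lambda>_. 1 :: real"] by simp
qed

lemma fix_mean_0: "fix_mean TYPE('a::{finite,field}) 0 \<phi> = \<phi> 1"
proof -
  have "card (fixed_vectors g) = 1" if "g \<in> isometries 0 J" for g J :: "'a mat"
  proof -
    have g: "g \<in> carrier_mat 0 0" using that by (simp add: isometries_def)
    have "carrier_vec 0 = {vNil :: 'a vec}" by auto
    moreover have "g *\<^sub>v vNil = vNil" using g by auto
    ultimately have "fixed_vectors g = {vNil}" unfolding fixed_vectors_carrier[OF g] by auto
    then show ?thesis by simp
  qed
  moreover have "1\<^sub>m 0 \<in> isometries 0 (hyp 0 :: 'a mat)" by (auto simp: isometries_def)
  then have "card (isometries 0 (hyp 0 :: 'a mat)) \<noteq> 0"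
    using finite_isometries[of 0 "hyp 0 :: 'a mat"] by (auto simp: card_eq_0_iff)
  ultimately show ?thesis
    unfolding fix_mean_hyp by (simp del: hyp.simps)
qed

text \<open>The number of nonzero vectors times the \<open>q^(2n+1)\<close> stabiliser elements over
  each h occurs both in the weighted sum and in the group order. It cancels in the quotient, leaving
  a recursion whose coefficients do not involve n.\<close>

lemma fix_mean_Suc:
  "fix_mean TYPE('a::{finite,field}) (Suc n) (\<lambda>N. (N - 1) * \<phi> N)
    = fix_mean TYPE('a) n (fix_step (real CARD('a)) \<phi>)"
proof -
  let ?m = "2 * n" and ?q = "real CARD('a)"
  have N: "2 * Suc n = Suc (Suc ?m)" by simp
  let ?J = "hyp (Suc n) :: 'a mat" and ?e = "vCons 1 (0\<^sub>v (Suc ?m)) :: 'a vec"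
  let ?H = "isometries ?m (hyp n :: 'a mat)"
  note alt = alt_form_hyp[of "Suc n", where 'a = 'a, unfolded N]
  note altn = alt_form_hyp[of n, where 'a = 'a]
  have e: "?e \<in> carrier_vec (Suc (Suc ?m))" "?e \<noteq> 0\<^sub>v (Suc (Suc ?m))" by (auto simp: zero_vec_Suc)
  have eu: "unit_vec (2 * Suc n) 0 = ?e"
    by (auto simp: vec_eq_iff vec_index_vCons unit_vec_def)
  have trans: "\<exists>P\<in>isometries (Suc (Suc ?m)) ?J. injective_mat (Suc (Suc ?m)) P \<and> P *\<^sub>v ?e = v"
    if v: "v \<in> carrier_vec (Suc (Suc ?m))" "v \<noteq> 0\<^sub>v (Suc (Suc ?m))" for v
    using symplectic_basis(2)[OF alt_form_hyp, of v "Suc n"] v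
    unfolding eu unfolding N isometries_def by (metis (mono_tags, lifting) injective_mat_carrier mem_Collect_eq)
  have stab: "{g. g \<in> isometries (Suc (Suc ?m)) ?J \<and> g *\<^sub>v ?e = ?e} = stabiliser ?m (hyp n)"
    by (simp add: stabiliser_def)
  have 1: "(\<Sum>g\<in>isometries (Suc (Suc ?m)) ?J. (real (card (fixed_vectors g)) - 1) * \<phi> (real (card (fixed_vectors g))))
     = (?q ^ Suc (Suc ?m) - 1) * (?q ^ Suc ?m * (\<Sum>h\<in>?H. fix_step ?q \<phi> (real (card (fixed_vectors h)))))"
    using sum_nonzero_fixed_vectors[OF alt_form_carrier[OF alt] e(1) trans, of \<phi>]
    unfolding stab sum_stabiliser[OF altn] .
  have "real (card (stabiliser ?m (hyp n :: 'a mat))) = ?q ^ Suc ?m * real (card ?H)"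
    using bij_betw_same_card[OF bij_betw_stab_mat[OF altn]]
    by (simp add: card_cartesian_product card_carrier_vec_field mult_ac flip: of_nat_power of_nat_mult)
  then have 2: "real (card (isometries (Suc (Suc ?m)) ?J)) = (?q ^ Suc (Suc ?m) - 1) * (?q ^ Suc ?m * real (card ?H))"
    using card_isometries_orbit[OF alt e trans] unfolding stab by simp
  have q: "?q \<ge> 2" using CARD_field_ge_2[where 'a = 'a] by simp
  then have "?q ^ Suc (Suc ?m) > 1" by (intro one_less_power) auto
  then have nz: "?q ^ Suc (Suc ?m) - 1 \<noteq> 0" "?q ^ Suc ?m \<noteq> 0" using q by auto
  show ?thesis
    unfolding fix_mean_hyp N 1 2 using nz by (simp del: power_Suc)
qed

section \<open>The Al-Salam-Carlitz series\<close>

text \<open>The expression in \<open>w_AC\<close> without its infinite product. For the parameters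
  of the theorem that product will be the reciprocal of the sum of these terms.\<close>

definition wt :: "real \<Rightarrow> real \<Rightarrow> nat \<Rightarrow> real" where
  "wt p b k = p ^ (k ^ 2) * b ^ k / (qpoch p p k * qpoch (b * p) p k)"

lemma qpoch_0 [simp]: "qpoch A B 0 = 1"
  by (simp add: qpoch_def)

lemma qpoch_Suc: "qpoch A B (Suc k) = qpoch A B k * (1 - A * B ^ k)"
  by (simp add: qpoch_def)

lemma wt_0 [simp]: "wt p b 0 = 1"
  by (simp add: wt_def)

lemma wt_Suc:
  "wt p b (Suc k) = wt p b k * (p ^ (2 * k + 1) * b / ((1 - p ^ Suc k) * (1 - b * p ^ Suc k)))"
proof -
  have "Suc k ^ 2 = k ^ 2 + (2 * k + 1)" by (simp add: power2_eq_square)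
  then show ?thesis
    by (simp add: wt_def qpoch_Suc power_add mult_ac)
qed

context
  fixes p b :: real
  assumes p: "0 < p" "p < 1" and b: "0 < b" "b * p < 1"
begin

lemma bp_power_less: "b * p ^ Suc k < 1"
proof -
  have "b * p ^ Suc k = (b * p) * p ^ k" by simp
  also have "\<dots> \<le> (b * p) * 1" using p b by (intro mult_left_mono power_le_one) auto
  finally show ?thesis by (rule le_less_trans) (use b in simp)
qed

lemma qpoch_shift: "qpoch (b * p * p) p k * (1 - b * p) = qpoch (b * p) p k * (1 - b * p ^ Suc k)"
  by (induction k) (simp_all add: qpoch_Suc mult_ac)

lemma wt_shift: "wt p (b * p) k = wt p b k * (p ^ k * (1 - b * p) / (1 - b * p ^ Suc k))"
proof -
  have nz: "1 - b * p \<noteq> 0" "1 - b * p ^ Suc k \<noteq> 0" using b bp_power_less[of k] by auto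
  have "qpoch (b * p * p) p k = qpoch (b * p) p k * (1 - b * p ^ Suc k) / (1 - b * p)"
    using qpoch_shift[of k] nz by (simp add: eq_divide_eq)
  then show ?thesis
    using nz by (simp add: wt_def power_mult_distrib)
qed

text \<open>A telescoping certificate for the shift of b: the right-hand side is a difference of
  consecutive values of \<open>wt p b k (1 - p^k)\<close>. With \<open>wt p b k\<close> factored
  out, only the rational identity \<open>r\<close> has to be checked.\<close>

lemma wt_telescope:
  "wt p b k - wt p (b * p) k / (1 - b * p) = wt p b k * (1 - p ^ k) - wt p b (Suc k) * (1 - p ^ Suc k)"
proof -
  have nz: "1 - b * p \<noteq> 0" "1 - b * p ^ Suc k \<noteq> 0" "1 - p ^ Suc k \<noteq> 0"
    using b bp_power_less[of k] p power_Suc_less_one[of p k] by auto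
  have r: "1 - p ^ k / (1 - b * p ^ Suc k) = (1 - p ^ k) - p ^ (2 * k + 1) * b / (1 - b * p ^ Suc k)"
  proof -
    have "p ^ (2 * k + 1) = p ^ k * p ^ Suc k" by (simp add: mult_2 power_add)
    then show ?thesis using nz by (simp add: field_simps)
  qed
  have "wt p (b * p) k / (1 - b * p) = wt p b k * (p ^ k / (1 - b * p ^ Suc k))"
    unfolding wt_shift using nz by (simp del: power_Suc)
  then have "wt p b k - wt p (b * p) k / (1 - b * p) = wt p b k * (1 - p ^ k / (1 - b * p ^ Suc k))"
    by (simp only: right_diff_distrib mult_1_right)
  also have "\<dots> = wt p b k * (1 - p ^ k) - wt p b k * (p ^ (2 * k + 1) * b / (1 - b * p ^ Suc k))"
    unfolding r by (simp only: right_diff_distrib)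
  also have "wt p b k * (p ^ (2 * k + 1) * b / (1 - b * p ^ Suc k)) = wt p b (Suc k) * (1 - p ^ Suc k)"
    unfolding wt_Suc using nz by (simp del: power_Suc)
  finally show ?thesis .
qed

text \<open>The telescoped sum is 0: \<open>?U\<close> vanishes at 0 because 1 - p^0 = 0, and it
  tends to 0 because the weights are summable.\<close>

lemma suminf_wt_shift:
  assumes s: "summable (wt p b)" "summable (wt p (b * p))"
  shows "suminf (wt p (b * p)) = (1 - b * p) * suminf (wt p b)"
proof -
  let ?U = "\<lambda>k. wt p b k * (1 - p ^ k)"
  have "(\<lambda>k. p ^ k) \<longlonglongrightarrow> 0" using p by (intro LIMSEQ_power_zero) auto
  then have "?U \<longlonglongrightarrow> 0 * (1 - 0)"
    by (intro tendsto_mult tendsto_diff tendsto_const summable_LIMSEQ_zero[OF s(1)])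
  then have "(\<lambda>k. ?U k - ?U (Suc k)) sums (?U 0 - 0)"
    by (intro telescope_sums') simp
  then have "(\<lambda>k. wt p b k - wt p (b * p) k / (1 - b * p)) sums 0"
    by (simp add: wt_telescope)
  moreover have "(\<lambda>k. wt p b k - wt p (b * p) k / (1 - b * p)) sums (suminf (wt p b) - suminf (wt p (b * p)) / (1 - b * p))"
    using s by (intro sums_diff sums_divide summable_sums)
  ultimately have "suminf (wt p b) - suminf (wt p (b * p)) / (1 - b * p) = 0" by (rule sums_unique2[OF _ _, symmetric])
  then show ?thesis using b by (simp add: field_simps)
qed

lemma qpoch_LIMSEQ: "(\<lambda>m. qpoch (b * p) p m) \<longlonglongrightarrow> qpoch_inf (b * p) p"
proof -
  have "summable (\<lambda>r. norm ((1 - b * p * p ^ r) - 1))"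
    using p b by (simp add: summable_mult summable_geometric abs_mult)
  then have "convergent_prod (\<lambda>r. 1 - b * p * p ^ r)"
    by (intro abs_convergent_prod_imp_convergent_prod summable_imp_abs_convergent_prod)
  then have "(\<lambda>m. \<Prod>r\<le>m. 1 - b * p * p ^ r) \<longlonglongrightarrow> qpoch_inf (b * p) p"
    unfolding qpoch_inf_def by (rule convergent_prod_LIMSEQ)
  then have "(\<lambda>m. qpoch (b * p) p (Suc m)) \<longlonglongrightarrow> qpoch_inf (b * p) p"
    by (simp add: qpoch_def lessThan_Suc_atMost)
  then show ?thesis by (rule LIMSEQ_imp_Suc)
qed

end

section \<open>The recursion for the geometric mixture\<close>

text \<open>The mixing variable takes natural values, so total probability can be written as an
  ordinary series, in which a shift of n is easy to carry out.\<close>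

lemma measure_bind_pmf_sums:
  fixes M :: "nat pmf"
  shows "(\<lambda>n. pmf M n * measure_pmf.prob (N n) A) sums measure_pmf.prob (bind_pmf M N) A"
proof -
  let ?f = "\<lambda>n. measure_pmf.prob (N n) A"
  have int: "integrable (measure_pmf M) ?f"
    by (rule measure_pmf.integrable_const_bound[where B = 1]) auto
  have "ennreal (measure_pmf.prob (bind_pmf M N) A) = (\<integral>\<^sup>+n. ennreal (?f n) \<partial>measure_pmf M)"
    by (simp flip: measure_pmf.emeasure_eq_measure)
  also have "\<dots> = ennreal (measure_pmf.expectation M ?f)"
    by (rule nn_integral_eq_integral[OF int]) simp
  finally have "measure_pmf.prob (bind_pmf M N) A = measure_pmf.expectation M ?f"
    by (simp add: integral_nonneg_AE)
  moreover have "measure_pmf.expectation M ?f = infsetsum (\<lambda>n. pmf M n * ?f n) UNIV"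
    by (rule pmf_expectation_eq_infsetsum)
  moreover have "(\<lambda>n. pmf M n * ?f n) sums infsetsum (\<lambda>n. pmf M n * ?f n) UNIV"
  proof (rule sums_infsetsum_nat')
    show "Infinite_Set_Sum.abs_summable_on (\<lambda>n. pmf M n * ?f n) UNIV"
      by (rule abs_summable_on_comparison_test'[OF pmf_abs_summable[of M]])
        (auto simp: abs_mult intro!: mult_left_le)
  qed
  ultimately show ?thesis by simp
qed

text \<open>Setting to 0 a coordinate that does not vanish identically on W divides its size by q,
  and the process ends at the zero space. Applied to fixed spaces, it shows that no value other than
  a power of q occurs.\<close>

lemma card_subsp:
  fixes W :: "'a::{finite,field} vec set"
  assumes "subsp n W"
  shows "\<exists>d. card W = CARD('a) ^ d"
  using assms
proof (induction "card W" arbitrary: W rule: less_induct)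
  case less
  have Wc: "W \<subseteq> carrier_vec n" and W0: "0\<^sub>v n \<in> W" using less.prems by (auto simp: subsp_def)
  have fin: "finite W" using Wc finite_carrier_vec_field by (rule finite_subset)
  show ?case
  proof (cases "W = {0\<^sub>v n}")
    case True
    then show ?thesis by (intro exI[of _ 0]) simp
  next
    case False
    then obtain w where w: "w \<in> W" "w \<noteq> 0\<^sub>v n" using W0 by blast
    then have wc: "w \<in> carrier_vec n" using Wc by blast
    obtain i where i: "i < n" "w $ i \<noteq> 0" by (rule nonzero_vec_componentE[OF wc w(2)])
    let ?W' = "{x \<in> W. x $ i = 0}"
    have c: "card W = CARD('a) * card ?W'"
      by (rule card_kernel_functional[where \<phi> = "\<lambda>x. x $ i" and w = w, OF less.prems])
        (use w i Wc in auto)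
    have "card ?W' < card W" using w(1) i by (intro psubset_card_mono[OF fin]) auto
    moreover have "subsp n ?W'" using less.prems i by (auto simp: subsp_def)
    ultimately obtain d where "card ?W' = CARD('a) ^ d" using less.hyps by blast
    then show ?thesis using c by (intro exI[of _ "Suc d"]) simp
  qed
qed

section \<open>Probabilities of single powers of q\<close>

definition pow_ind :: "real \<Rightarrow> nat \<Rightarrow> real \<Rightarrow> real" where
  "pow_ind q y N = (if N = q ^ y then 1 else 0)"

text \<open>Only natural arguments matter. This is essential in \<open>fix_prob_1\<close>, where the
  functions compared differ at the real argument 1 / q.\<close>

lemma fix_mean_cong:
  assumes "\<And>k. \<phi> (real k) = \<psi> (real k)"
  shows "fix_mean TYPE('a::{finite,field}) n \<phi> = fix_mean TYPE('a) n \<psi>"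
  using assms by (simp add: fix_mean_def)

lemma fix_mean_add: "fix_mean TYPE('a::{finite,field}) n (\<lambda>N. \<phi> N + \<psi> N)
    = fix_mean TYPE('a) n \<phi> + fix_mean TYPE('a) n \<psi>"
  by (simp add: fix_mean_def sum.distrib add_divide_distrib)

lemma fix_mean_cmult: "fix_mean TYPE('a::{finite,field}) n (\<lambda>N. c * \<phi> N) = c * fix_mean TYPE('a) n \<phi>"
  by (simp add: fix_mean_def sum_distrib_left)

definition fix_prob :: "real \<Rightarrow> 'a::{finite,field} itself \<Rightarrow> nat \<Rightarrow> real" where
  "fix_prob a _ y = measure_pmf.prob (random_symplectic a :: 'a mat pmf)
     {g. card (fixed_vectors g) = CARD('a) ^ y}"

context
  fixes a :: real
  assumes a: "0 < a" "a < 1"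
begin

lemma fix_prob_sums:
  "(\<lambda>n. (1 - a) * a ^ n * fix_mean TYPE('a::{finite,field}) n (pow_ind (real CARD('a)) y)) sums fix_prob a TYPE('a) y"
proof -
  let ?A = "{g. card (fixed_vectors g) = CARD('a) ^ y} :: 'a mat set"
  have "measure_pmf.prob (pmf_of_set (Sp n)) ?A = fix_mean TYPE('a) n (pow_ind (real CARD('a)) y)" for n
  proof -
    have ne: "Sp n \<noteq> ({} :: 'a mat set)" using one_in_Sp[of n, where 'a = 'a] by blast
    have "real (card (Sp n \<inter> ?A)) = (\<Sum>g\<in>Sp n. if g \<in> ?A then 1 else 0)"
      using finite_Sp[of n, where 'a = 'a] by (simp add: sum.If_cases)
    also have "\<dots> = (\<Sum>g\<in>Sp n. pow_ind (real CARD('a)) y (real (card (fixed_vectors (g :: 'a mat)))))"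
      by (intro sum.cong refl) (simp add: pow_ind_def flip: of_nat_power)
    finally show ?thesis
      by (simp add: measure_pmf_of_set[OF ne finite_Sp] fix_mean_def)
  qed
  moreover have "pmf (geometric_pmf (1 - a)) n = (1 - a) * a ^ n" for n
    using a by (simp add: mult.commute)
  ultimately show ?thesis
    using measure_bind_pmf_sums[of "geometric_pmf (1 - a)" "\<lambda>n. pmf_of_set (Sp n)" ?A]
    unfolding fix_prob_def random_symplectic_def by simp
qed

text \<open>On the indicator of \<open>q^y\<close> the factor N - 1 is the constant
  \<open>q^y - 1\<close>, so \<open>fix_mean_Suc\<close> expresses the mean at n + 1 through \<Phi>
  at n. Shifting the geometric weights costs one factor a.\<close>

lemma fix_prob_recurrence:
  assumes y: "y > 0" and \<phi>: "\<And>n. fix_mean TYPE('a::{finite,field}) n (fix_step (real CARD('a)) (pow_ind (real CARD('a)) y)) = \<Phi> n"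
    and sums: "(\<lambda>n. (1 - a) * a ^ n * \<Phi> n) sums s"
  shows "(real CARD('a) ^ y - 1) * fix_prob a TYPE('a) y = a * s"
proof -
  let ?q = "real CARD('a)" and ?F = "fix_mean TYPE('a)"
  let ?I = "pow_ind ?q y"
  have q: "?q \<ge> 2" using CARD_field_ge_2[where 'a = 'a] by simp
  have mult: "(?q ^ y - 1) * ?F n ?I = ?F n (\<lambda>N. (N - 1) * ?I N)" for n
    unfolding fix_mean_cmult[symmetric] by (rule fix_mean_cong) (simp add: pow_ind_def)
  have "?q ^ y > 1" using q y by (intro one_less_power) auto
  then have F0: "?F 0 ?I = 0" by (simp add: fix_mean_0 pow_ind_def)
  have "(\<lambda>n. (?q ^ y - 1) * ((1 - a) * a ^ n * ?F n ?I)) sums ((?q ^ y - 1) * fix_prob a TYPE('a) y)"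
    by (intro sums_mult fix_prob_sums)
  \<comment> \<open>The term n = 0 drops out: the trivial group has one fixed vector, which is not
    \<open>q^y\<close> when y > 0.\<close>
  then have "(\<lambda>n. (?q ^ y - 1) * ((1 - a) * a ^ Suc n * ?F (Suc n) ?I)) sums ((?q ^ y - 1) * fix_prob a TYPE('a) y)"
    by (subst sums_Suc_iff) (simp add: F0)
  moreover have "(?q ^ y - 1) * ((1 - a) * a ^ Suc n * ?F (Suc n) ?I) = a * ((1 - a) * a ^ n * \<Phi> n)" for n
  proof -
    have "(?q ^ y - 1) * ((1 - a) * a ^ Suc n * ?F (Suc n) ?I) = (1 - a) * a ^ Suc n * ((?q ^ y - 1) * ?F (Suc n) ?I)"
      by (simp add: mult_ac)
    also have "(?q ^ y - 1) * ?F (Suc n) ?I = \<Phi> n" unfolding mult fix_mean_Suc \<phi> ..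
    finally show ?thesis by (simp add: mult_ac)
  qed
  ultimately have "(\<lambda>n. a * ((1 - a) * a ^ n * \<Phi> n)) sums ((?q ^ y - 1) * fix_prob a TYPE('a) y)"
    by (simp only:)
  moreover have "(\<lambda>n. a * ((1 - a) * a ^ n * \<Phi> n)) sums (a * s)" by (intro sums_mult sums)
  ultimately show ?thesis by (rule sums_unique2)
qed

text \<open>For y = 1 the jump by \<open>q^2\<close> would have to start from 1 / q fixed vectors,
  which is impossible; only N = 1 and N = q contribute.\<close>

lemma fix_prob_1:
  "(real CARD('a) - a) * fix_prob a TYPE('a::{finite,field}) 1 = a * fix_prob a TYPE('a) 0"
proof -
  let ?q = "real CARD('a)" and ?F = "fix_mean TYPE('a)" and ?p = "fix_prob a TYPE('a)"
  have q: "?q \<ge> 2" using CARD_field_ge_2[where 'a = 'a] by simp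
  have "fix_step ?q (pow_ind ?q 1) (real k) = (1 - 1 / ?q) * pow_ind ?q 1 (real k) + (1 - 1 / ?q) * pow_ind ?q 0 (real k)" for k
  proof -
    have "CARD('a)\<^sup>2 * k \<noteq> CARD('a)"
    proof
      assume "CARD('a)\<^sup>2 * k = CARD('a)"
      then have "CARD('a) * k = 1" by (simp add: power2_eq_square)
      then show False using CARD_field_ge_2[where 'a = 'a] by simp
    qed
    then have "?q\<^sup>2 * real k \<noteq> ?q" by (metis of_nat_eq_iff of_nat_mult of_nat_power)
    moreover have "?q * real k = ?q \<longleftrightarrow> real k = 1" using q by simp
    ultimately show ?thesis by (auto simp: fix_step_def pow_ind_def)
  qed
  then have "?F n (fix_step ?q (pow_ind ?q 1)) = (1 - 1 / ?q) * ?F n (pow_ind ?q 1) + (1 - 1 / ?q) * ?F n (pow_ind ?q 0)" for n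
    unfolding fix_mean_cmult[symmetric] fix_mean_add[symmetric] by (rule fix_mean_cong)
  moreover have "(\<lambda>n. (1 - a) * a ^ n * ((1 - 1 / ?q) * ?F n (pow_ind ?q 1) + (1 - 1 / ?q) * ?F n (pow_ind ?q 0)))
      sums ((1 - 1 / ?q) * ?p 1 + (1 - 1 / ?q) * ?p 0)"
    using sums_add[OF sums_mult[OF fix_prob_sums, of "1 - 1 / ?q"] sums_mult[OF fix_prob_sums, of "1 - 1 / ?q"]]
    by (simp add: distrib_left mult_ac)
  ultimately have "(?q ^ 1 - 1) * ?p 1 = a * ((1 - 1 / ?q) * ?p 1 + (1 - 1 / ?q) * ?p 0)"
    by (intro fix_prob_recurrence) simp_all
  then have "?q * ((?q - 1) * ?p 1) = ?q * (a * ((1 - 1 / ?q) * (?p 1 + ?p 0)))"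
    by (simp only: distrib_left power_one_right)
  then have "(?q - 1) * (?q * ?p 1) = ?q * (a * ((1 - 1 / ?q) * (?p 1 + ?p 0)))"
    by (simp only: mult.left_commute)
  also have "\<dots> = (?q - 1) * (a * (?p 1 + ?p 0))"
  proof -
    have "?q * (1 - 1 / ?q) = ?q - 1" using q by (simp add: right_diff_distrib)
    then show ?thesis by (metis mult.assoc mult.left_commute)
  qed
  finally have "?q * ?p 1 = a * (?p 1 + ?p 0)" using q by simp
  then show ?thesis by (simp add: algebra_simps)
qed

lemma fix_prob_Suc_Suc:
  fixes y
  defines "Y \<equiv> real CARD('a::{finite,field}) ^ Suc (Suc y)"
  shows "(Y - 1) * (Y - a) * fix_prob a TYPE('a) (Suc (Suc y)) =
     a * (real CARD('a) * fix_prob a TYPE('a) y + (real CARD('a) - 1) * fix_prob a TYPE('a) (Suc y))"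
proof -
  let ?q = "real CARD('a)" and ?F = "fix_mean TYPE('a)" and ?p = "fix_prob a TYPE('a)"
  \<comment> \<open>The same constant serves twice: it is 1 / (q N) at N = \<open>q^y\<close> and 1
    / N at N = \<open>q^(y+1)\<close>.\<close>
  let ?c = "1 / ?q ^ Suc y"
  have q: "?q \<ge> 2" using CARD_field_ge_2[where 'a = 'a] by simp
  have "fix_step ?q (pow_ind ?q (Suc (Suc y))) N = (1 - 1 / Y) * pow_ind ?q (Suc (Suc y)) N
      + (?c * pow_ind ?q y N + (1 - 1 / ?q) * ?c * pow_ind ?q (Suc y) N)" for N
  proof -
    have "?q\<^sup>2 * N = ?q ^ Suc (Suc y) \<longleftrightarrow> N = ?q ^ y" "?q * N = ?q ^ Suc (Suc y) \<longleftrightarrow> N = ?q ^ Suc y"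
      using q by (auto simp: power2_eq_square mult.assoc)
    then show ?thesis
      by (auto simp: fix_step_def pow_ind_def Y_def)
  qed
  then have "?F n (fix_step ?q (pow_ind ?q (Suc (Suc y)))) = (1 - 1 / Y) * ?F n (pow_ind ?q (Suc (Suc y)))
      + (?c * ?F n (pow_ind ?q y) + (1 - 1 / ?q) * ?c * ?F n (pow_ind ?q (Suc y)))" for n
    unfolding fix_mean_cmult[symmetric] fix_mean_add[symmetric] by (rule fix_mean_cong)
  moreover have "(\<lambda>n. (1 - a) * a ^ n * ((1 - 1 / Y) * ?F n (pow_ind ?q (Suc (Suc y)))
      + (?c * ?F n (pow_ind ?q y) + (1 - 1 / ?q) * ?c * ?F n (pow_ind ?q (Suc y)))))
      sums ((1 - 1 / Y) * ?p (Suc (Suc y)) + (?c * ?p y + (1 - 1 / ?q) * ?c * ?p (Suc y)))"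
    using sums_add[OF sums_mult[OF fix_prob_sums[of "Suc (Suc y)"], of "1 - 1 / Y"]
        sums_add[OF sums_mult[OF fix_prob_sums[of y], of ?c] sums_mult[OF fix_prob_sums[of "Suc y"], of "(1 - 1 / ?q) * ?c"]]]
    by (simp only: distrib_left mult_ac)
  ultimately have "(Y - 1) * ?p (Suc (Suc y)) = a * ((1 - 1 / Y) * ?p (Suc (Suc y)) + (?c * ?p y + (1 - 1 / ?q) * ?c * ?p (Suc y)))"
    unfolding Y_def by (intro fix_prob_recurrence) simp_all
  moreover have c: "?c = ?q / Y" using q by (simp add: Y_def)
  moreover have Y: "Y > 0" using q by (simp add: Y_def)
  moreover have alg: "a * ((1 - 1 / Z) * A + (r / Z * B + (1 - 1 / r) * (r / Z) * C)) * Z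
      = a * ((Z - 1) * A + (r * B + (r - 1) * C))" if "Z \<noteq> 0" "r \<noteq> 0" for Z r A B C :: real
    using that by (simp add: field_simps)
  \<comment> \<open>The unknown for y + 2 also occurs on the right; moving it to the left turns the
    factor Y into Y - a.\<close>
  ultimately have "(Y - 1) * ?p (Suc (Suc y)) * Y = a * ((Y - 1) * ?p (Suc (Suc y)) + (?q * ?p y + (?q - 1) * ?p (Suc y)))"
    unfolding c using q by (simp only: alg[of Y ?q])
  then show ?thesis by (simp add: algebra_simps)
qed

end

section \<open>The distribution of the number of fixed vectors\<close>

definition pair_prob :: "real \<Rightarrow> 'a::{finite,field} itself \<Rightarrow> nat \<Rightarrow> real" where
  "pair_prob a _ k = measure_pmf.prob (random_symplectic a :: 'a mat pmf)
     {g. card (fixed_vectors g) = CARD('a) ^ (2 * k) \<or> card (fixed_vectors g) = CARD('a) ^ (2 * k + 1)}"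

context
  fixes a :: real
  assumes a: "0 < a" "a < 1"
begin

text \<open>The two relations feed each other. Inserting the first into the recursion for exponent
  2k + 2 makes the right-hand side divisible by Y - a and gives the second; inserting the second
  into the recursion for 2k + 3 makes it divisible by Y - 1 and gives the first for k + 1. The start
  is \<open>fix_prob_1\<close>.\<close>

lemma fix_prob_even_odd:
  defines "Q \<equiv> real CARD('a::{finite,field})" and "P \<equiv> fix_prob a TYPE('a)"
  shows "(Q ^ Suc (2 * k) - a) * P (Suc (2 * k)) = a * P (2 * k)"
    and "P (Suc (2 * k)) = (Q ^ Suc (Suc (2 * k)) - 1) * P (Suc (Suc (2 * k)))"
proof -
  have Q: "Q \<ge> 2" unfolding Q_def using CARD_field_ge_2[where 'a = 'a] by simp
  have pow: "Q ^ Suc n > 1" for n using Q by (intro one_less_power) auto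
  note rec = fix_prob_Suc_Suc[OF a, where 'a = 'a, folded Q_def P_def]
  have even: "P (Suc n) = (Q ^ Suc (Suc n) - 1) * P (Suc (Suc n))"
    if h: "(Q ^ Suc n - a) * P (Suc n) = a * P n" for n
  proof -
    let ?x = "Q ^ Suc (Suc n)"
    have "(?x - a) * ((?x - 1) * P (Suc (Suc n))) = Q * (a * P n) + a * (Q - 1) * P (Suc n)"
      using rec[of n] by (simp add: algebra_simps)
    also have "\<dots> = (?x - a) * P (Suc n)"
      unfolding h[symmetric] by (simp add: algebra_simps)
    finally show ?thesis using pow[of "Suc n"] a by simp
  qed
  have odd: "(Q ^ Suc (2 * k) - a) * P (Suc (2 * k)) = a * P (2 * k)" for k
  proof (induction k)
    case 0
    then show ?case using fix_prob_1[OF a, where 'a = 'a] by (simp add: Q_def P_def)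
  next
    case (Suc k)
    let ?n = "2 * k" and ?z = "Q ^ Suc (Suc (Suc (2 * k)))"
    have "(?z - 1) * ((?z - a) * P (Suc (Suc (Suc ?n)))) = a * (Q * P (Suc ?n) + (Q - 1) * P (Suc (Suc ?n)))"
      using rec[of "Suc ?n"] by (simp add: mult.assoc)
    also have "\<dots> = (?z - 1) * (a * P (Suc (Suc ?n)))"
      unfolding even[OF Suc.IH] by (simp add: algebra_simps)
    finally show ?case using pow[of "Suc (Suc ?n)"] by simp
  qed
  show "(Q ^ Suc (2 * k) - a) * P (Suc (2 * k)) = a * P (2 * k)" by (rule odd)
  show "P (Suc (2 * k)) = (Q ^ Suc (Suc (2 * k)) - 1) * P (Suc (Suc (2 * k)))" by (rule even[OF odd])
qed

lemma pair_prob_eq: "pair_prob a TYPE('a::{finite,field}) k = fix_prob a TYPE('a) (2 * k) + fix_prob a TYPE('a) (Suc (2 * k))"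
proof -
  let ?A = "\<lambda>y. {g. card (fixed_vectors g) = CARD('a) ^ y} :: 'a mat set"
  have "CARD('a) \<ge> 2" by (rule CARD_field_ge_2)
  then have "?A (2 * k) \<inter> ?A (Suc (2 * k)) = {}" by auto
  moreover have "{g. card (fixed_vectors g) = CARD('a) ^ (2 * k) \<or> card (fixed_vectors g) = CARD('a) ^ (2 * k + 1)}
      = ?A (2 * k) \<union> ?A (Suc (2 * k))" by auto
  ultimately show ?thesis
    unfolding pair_prob_def fix_prob_def by (simp only: measure_pmf.finite_measure_Union sets_measure_pmf UNIV_I)
qed

text \<open>By the first relation each pair sum is a multiple of one of its members: the sum for k
  of P(2k+1), the sum for k + 1 of P(2k+2). The second relation links these two.\<close>

lemma pair_prob_Suc:
  defines "Q \<equiv> real CARD('a::{finite,field})"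
  shows "pair_prob a TYPE('a) (Suc k) = pair_prob a TYPE('a) k *
    (a * Q\<^sup>2 / ((Q ^ Suc (Suc (2 * k)) - 1) * (Q ^ Suc (Suc (Suc (2 * k))) - a)))"
proof -
  let ?P = "fix_prob a TYPE('a)" and ?n = "2 * k"
  let ?y = "Q ^ Suc ?n" and ?x = "Q ^ Suc (Suc ?n)" and ?z = "Q ^ Suc (Suc (Suc ?n))"
  have Q: "Q \<ge> 2" unfolding Q_def using CARD_field_ge_2[where 'a = 'a] by simp
  have pow: "Q ^ Suc n > 1" for n using Q by (intro one_less_power) auto
  note eo = fix_prob_even_odd[where 'a = 'a, folded Q_def]
  have 1: "(?y - a) * ?P (Suc ?n) = a * ?P ?n" by (rule eo(1))
  have 2: "?P (Suc ?n) = (?x - 1) * ?P (Suc (Suc ?n))" by (rule eo(2))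
  have 3: "(?z - a) * ?P (Suc (Suc (Suc ?n))) = a * ?P (Suc (Suc ?n))" using eo(1)[of "Suc k"] by simp
  have S: "pair_prob a TYPE('a) (Suc k) = ?P (Suc (Suc ?n)) + ?P (Suc (Suc (Suc ?n)))"
    by (simp add: pair_prob_eq)
  have "((?x - 1) * (?z - a)) * pair_prob a TYPE('a) (Suc k) = (?x - 1) * ((?z - a) * ?P (Suc (Suc ?n)) + (?z - a) * ?P (Suc (Suc (Suc ?n))))"
    unfolding S by (simp only: distrib_left mult.assoc)
  also have "\<dots> = ?z * ((?x - 1) * ?P (Suc (Suc ?n)))"
    unfolding 3 by (simp add: algebra_simps)
  also have "\<dots> = ?z * ?P (Suc ?n)" unfolding 2 ..
  also have "\<dots> = a * Q\<^sup>2 * pair_prob a TYPE('a) k"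
  proof -
    have "a * pair_prob a TYPE('a) k = a * ?P ?n + a * ?P (Suc ?n)" by (simp add: pair_prob_eq distrib_left)
    also have "\<dots> = ?y * ?P (Suc ?n)" unfolding 1[symmetric] by (simp add: algebra_simps)
    finally have "a * pair_prob a TYPE('a) k = ?y * ?P (Suc ?n)" .
    moreover have "?z * ?P (Suc ?n) = Q\<^sup>2 * (?y * ?P (Suc ?n))" by (simp add: power2_eq_square)
    ultimately have "?z * ?P (Suc ?n) = Q\<^sup>2 * (a * pair_prob a TYPE('a) k)" by (simp only:)
    then show ?thesis by (simp only: mult_ac)
  qed
  finally have e: "((?x - 1) * (?z - a)) * pair_prob a TYPE('a) (Suc k) = a * Q\<^sup>2 * pair_prob a TYPE('a) k" .
  have "(?x - 1) * (?z - a) \<noteq> 0" using pow[of "Suc ?n"] pow[of "Suc (Suc ?n)"] a by simp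
  then have "pair_prob a TYPE('a) (Suc k) = a * Q\<^sup>2 * pair_prob a TYPE('a) k / ((?x - 1) * (?z - a))"
    using e by (metis nonzero_mult_div_cancel_left)
  then show ?thesis by (simp only: mult.commute times_divide_eq_left times_divide_eq_right)
qed

lemma pair_prob_wt:
  defines "Q \<equiv> real CARD('a::{finite,field})"
  shows "pair_prob a TYPE('a) k = pair_prob a TYPE('a) 0 * wt (1 / Q\<^sup>2) (a / Q) k"
proof (induction k)
  case (Suc k)
  let ?p = "1 / Q\<^sup>2" and ?x = "Q ^ Suc (Suc (2 * k))"
  have Q: "Q \<ge> 2" unfolding Q_def using CARD_field_ge_2[where 'a = 'a] by simp
  have x: "?x > 1" using Q by (intro one_less_power) auto
  have xp: "?x = (Q\<^sup>2) ^ Suc k" by (simp add: power2_eq_square power_mult_distrib flip: power_mult)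
    (simp add: power_mult_distrib mult_2 power_add)
  have p1: "?p ^ Suc k = 1 / ?x" by (simp only: xp power_one_over)
  have p2: "?p ^ (2 * k + 1) = Q\<^sup>2 / (?x * ?x)"
  proof -
    have e: "(Q\<^sup>2) ^ (2 * k + 1) = (Q\<^sup>2) ^ k * (Q\<^sup>2) ^ k * Q\<^sup>2"
      by (simp only: mult_2 power_add power_one_right)
    have "?x * ?x = (Q\<^sup>2) ^ (2 * k + 1) * Q\<^sup>2" unfolding xp e by simp
    then show ?thesis using Q by (simp add: power_one_over)
  qed
  \<comment> \<open>For r = q and y = \<open>q^(2k+2)\<close> the left side is the ratio in
    \<open>wt_Suc\<close> at p = 1 / q^2 and b = a / q, the right side the ratio in
    \<open>pair_prob_Suc\<close>.\<close>
  have alg: "r\<^sup>2 / (y * y) * (a / r) / ((1 - 1 / y) * (1 - a / r * (1 / y))) = a * r\<^sup>2 / ((y - 1) * (r * y - a))"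
    if "r \<ge> 2" "y > 1" for r y :: real
  proof -
    have "a < r * y" using mult_strict_mono[of 1 r 1 y] that a by simp
    then have nz: "r \<noteq> 0" "y \<noteq> 0" "y - 1 \<noteq> 0" "r * y - a \<noteq> 0" using that by auto
    have "1 - 1 / y = (y - 1) / y" "1 - a / r * (1 / y) = (r * y - a) / (r * y)"
      using nz by (simp_all add: diff_divide_distrib)
    then show ?thesis using nz by (simp add: power2_eq_square)
  qed
  have "wt ?p (a / Q) (Suc k) = wt ?p (a / Q) k * (a * Q\<^sup>2 / ((?x - 1) * (Q * ?x - a)))"
    unfolding wt_Suc p1 p2 alg[OF Q x] ..
  then show ?case
    unfolding pair_prob_Suc[where 'a = 'a, folded Q_def] Suc.IH by simp
qed simp

section \<open>Total mass and the normalising constant\<close>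

lemma pair_prob_sums: "pair_prob a TYPE('a::{finite,field}) sums 1"
proof -
  let ?M = "random_symplectic a :: 'a mat pmf"
  let ?A = "\<lambda>k. {g. card (fixed_vectors g) = CARD('a) ^ (2 * k) \<or> card (fixed_vectors g) = CARD('a) ^ (2 * k + 1)} :: 'a mat set"
  have q: "CARD('a) \<ge> 2" by (rule CARD_field_ge_2)
  have "disjoint_family ?A"
    unfolding disjoint_family_on_def
  proof (intro ballI impI)
    fix k l :: nat assume "k \<noteq> l"
    have inj: "CARD('a) ^ i = CARD('a) ^ j \<longleftrightarrow> i = j" for i j using q by simp
    show "?A k \<inter> ?A l = {}"
    proof (rule equals0I)
      fix g assume "g \<in> ?A k \<inter> ?A l"
      then have "\<exists>i\<in>{2 * k, 2 * k + 1}. \<exists>j\<in>{2 * l, 2 * l + 1}. CARD('a) ^ i = CARD('a) ^ j" by auto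
      then have "\<exists>i\<in>{2 * k, 2 * k + 1}. \<exists>j\<in>{2 * l, 2 * l + 1}. i = j" unfolding inj .
      with \<open>k \<noteq> l\<close> show False by auto
    qed
  qed
  then have "(\<lambda>k. measure_pmf.prob ?M (?A k)) sums measure_pmf.prob ?M (\<Union>k. ?A k)"
    by (intro measure_pmf.finite_measure_UNION) auto
  moreover have "measure_pmf.prob ?M (\<Union>k. ?A k) = 1"
  proof -
    \<comment> \<open>Fixed vectors form a subspace, so their number is a power of q, and its
      exponent has the form 2j or 2j + 1.\<close>
    have "\<exists>k. g \<in> ?A k" if g: "g \<in> Sp n" for g n
    proof -
      have "g \<in> carrier_mat (2 * n) (2 * n)" using g by (simp add: Sp_def)
      then obtain d where d: "card (fixed_vectors g) = CARD('a) ^ d"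
        using card_subsp[OF subsp_fixed_vectors] by blast
      obtain j where "d = 2 * j \<or> d = 2 * j + 1" by (metis evenE oddE)
      then have "g \<in> ?A j" using d by auto
      then show ?thesis ..
    qed
    moreover have "Sp n \<noteq> ({} :: 'a mat set)" for n using one_in_Sp[of n, where 'a = 'a] by blast
    ultimately have "\<forall>g\<in>set_pmf ?M. g \<in> (\<Union>k. ?A k)"
      by (auto simp: random_symplectic_def set_pmf_of_set finite_Sp)
    then show ?thesis by (intro measure_pmf.prob_eq_1[THEN iffD2]) (auto simp: AE_measure_pmf_iff)
  qed
  ultimately show ?thesis by (simp only: pair_prob_def [abs_def])
qed

text \<open>The lower bound is the term n = 0 alone: with probability 1 - a the group is trivial and
  has exactly one fixed vector. It permits division by this probability and later drives its limit
  to 1.\<close>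

lemma pair_prob_0_bounds: "1 - a \<le> pair_prob a TYPE('a::{finite,field}) 0" "pair_prob a TYPE('a) 0 \<le> 1"
proof -
  let ?f = "\<lambda>n. (1 - a) * a ^ n * fix_mean TYPE('a) n (pow_ind (real CARD('a)) 0)"
  have "fix_mean TYPE('a) n (pow_ind (real CARD('a)) 0) \<ge> 0" for n
    by (auto simp: fix_mean_def pow_ind_def intro!: divide_nonneg_nonneg sum_nonneg)
  then have "?f n \<ge> 0" for n using a by simp
  then have "sum ?f {..<1} \<le> suminf ?f"
    using sums_summable[OF fix_prob_sums[OF a, of 0, where 'a = 'a]] by (intro sum_le_suminf) auto
  also have "suminf ?f = fix_prob a TYPE('a) 0"
    using fix_prob_sums[OF a, of 0, where 'a = 'a] by (rule sums_unique[symmetric])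
  finally have "1 - a \<le> fix_prob a TYPE('a) 0" by (simp add: fix_mean_0 pow_ind_def)
  also have "\<dots> \<le> pair_prob a TYPE('a) 0" by (simp add: pair_prob_eq fix_prob_def)
  finally show "1 - a \<le> pair_prob a TYPE('a) 0" .
  show "pair_prob a TYPE('a) 0 \<le> 1" by (simp add: pair_prob_def)
qed

text \<open>Dividing the total mass 1 by the probability at k = 0 yields both the convergence and
  the value of the series of weights.\<close>

lemma wt_sums: "wt (1 / (real CARD('a::{finite,field}))\<^sup>2) (a / real CARD('a)) sums (1 / pair_prob a TYPE('a) 0)"
proof -
  let ?w = "wt (1 / (real CARD('a))\<^sup>2) (a / real CARD('a))"
  have nz: "pair_prob a TYPE('a) 0 \<noteq> 0" using pair_prob_0_bounds[where 'a = 'a] a by linarith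
  have "pair_prob a TYPE('a) k / pair_prob a TYPE('a) 0 = ?w k" for k
    using nz by (subst pair_prob_wt) simp
  then show ?thesis
    using sums_divide[OF pair_prob_sums[where 'a = 'a], of "pair_prob a TYPE('a) 0"] by simp
qed

end

text \<open>Both probabilities are reciprocals of series of weights. Replacing a by a p keeps the
  mixing parameter in (0,1) and replaces b = a / q by b p, so \<open>suminf_wt_shift\<close>
  compares the two series.\<close>

lemma pair_prob_0_shift:
  fixes a :: real
  defines "Q \<equiv> real CARD('a::{finite,field})"
  assumes a: "0 < a" "a < 1"
  shows "pair_prob a TYPE('a) 0 = (1 - a / Q * (1 / Q\<^sup>2)) * pair_prob (a * (1 / Q\<^sup>2)) TYPE('a) 0"
proof -
  let ?p = "1 / Q\<^sup>2"
  have Q: "Q \<ge> 2" unfolding Q_def using CARD_field_ge_2[where 'a = 'a] by simp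
  have p: "0 < ?p" "?p < 1" using Q one_less_power[of Q 2] by auto
  have ap: "0 < a * ?p" "a * ?p < 1" using a p mult_strict_mono[of a 1 ?p 1] by auto
  have b: "0 < a / Q" "a / Q * ?p < 1"
  proof -
    have "a / Q < 1" using a Q by simp
    then have "a / Q * ?p < 1 * 1" using a Q p by (intro mult_strict_mono) auto
    then show "0 < a / Q" "a / Q * ?p < 1" using a Q by auto
  qed
  have eq: "a * ?p / Q = a / Q * ?p" by simp
  note s1 = wt_sums[OF a, where 'a = 'a, folded Q_def]
  note s2 = wt_sums[OF ap, where 'a = 'a, folded Q_def, unfolded eq]
  have "suminf (wt ?p (a / Q * ?p)) = (1 - a / Q * ?p) * suminf (wt ?p (a / Q))"
    by (rule suminf_wt_shift[OF p b sums_summable[OF s1] sums_summable[OF s2]])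
  then have "1 / pair_prob (a * ?p) TYPE('a) 0 = (1 - a / Q * ?p) * (1 / pair_prob a TYPE('a) 0)"
    using sums_unique[OF s1] sums_unique[OF s2] by simp
  moreover have "pair_prob (a * ?p) TYPE('a) 0 > 0" "pair_prob a TYPE('a) 0 > 0"
    using pair_prob_0_bounds(1)[OF a, where 'a = 'a] pair_prob_0_bounds(1)[OF ap, where 'a = 'a] a ap by linarith+
  ultimately show ?thesis by (simp add: divide_eq_eq eq_divide_eq)
qed

text \<open>Iterating the shift m times collects the factors of the finite product and leaves the
  probability for a p^m, which is squeezed between 1 - a p^m and 1.\<close>

lemma pair_prob_0:
  fixes a :: real
  defines "Q \<equiv> real CARD('a::{finite,field})"
  assumes a: "0 < a" "a < 1"
  shows "pair_prob a TYPE('a) 0 = qpoch_inf (a / Q * (1 / Q\<^sup>2)) (1 / Q\<^sup>2)"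
proof -
  let ?p = "1 / Q\<^sup>2"
  have Q: "Q \<ge> 2" unfolding Q_def using CARD_field_ge_2[where 'a = 'a] by simp
  have p: "0 < ?p" "?p < 1" using Q one_less_power[of Q 2] by auto
  have apm: "0 < a * ?p ^ m" "a * ?p ^ m < 1" for m
  proof -
    have "a * ?p ^ m \<le> a * 1" using a p by (intro mult_left_mono power_le_one) auto
    then show "a * ?p ^ m < 1" using a by linarith
    show "0 < a * ?p ^ m" using a p by simp
  qed
  have iter: "pair_prob a TYPE('a) 0 = qpoch (a / Q * ?p) ?p m * pair_prob (a * ?p ^ m) TYPE('a) 0" for m
  proof (induction m)
    case (Suc m)
    show ?case
      unfolding Suc.IH pair_prob_0_shift[OF apm[of m], where 'a = 'a, folded Q_def] qpoch_Suc
      by (simp add: mult_ac)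
  qed simp
  have lim: "(\<lambda>m. pair_prob (a * ?p ^ m) TYPE('a) 0) \<longlonglongrightarrow> 1"
  proof (rule tendsto_sandwich)
    have "(\<lambda>m. 1 - a * ?p ^ m) \<longlonglongrightarrow> 1 - a * 0"
      using p by (intro tendsto_intros LIMSEQ_power_zero) auto
    then show "(\<lambda>m. 1 - a * ?p ^ m) \<longlonglongrightarrow> 1" by simp
  qed (use pair_prob_0_bounds[OF apm, where 'a = 'a] in auto)
  have b: "0 < a / Q" "a / Q * ?p < 1"
  proof -
    have "a / Q < 1" using a Q by simp
    then have "a / Q * ?p < 1 * 1" using a Q p by (intro mult_strict_mono) auto
    then show "0 < a / Q" "a / Q * ?p < 1" using a Q by auto
  qed
  have "(\<lambda>m. qpoch (a / Q * ?p) ?p m * pair_prob (a * ?p ^ m) TYPE('a) 0) \<longlonglongrightarrow> qpoch_inf (a / Q * ?p) ?p * 1"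
    by (intro tendsto_mult lim qpoch_LIMSEQ p b)
  then have "(\<lambda>m. pair_prob a TYPE('a) 0) \<longlonglongrightarrow> qpoch_inf (a / Q * ?p) ?p"
    by (simp only: iter[symmetric] mult_1_right)
  then show ?thesis by (rule LIMSEQ_unique[OF tendsto_const])
qed

theorem theorem5p9:
  fixes a :: real and q k :: nat
  assumes q: "CARD('a::{finite,field}) = q"
    and a: "0 < a" "a < 1"
  shows "measure_pmf.prob (random_symplectic a :: 'a mat pmf)
           {g. card (fixed_vectors g) = q ^ (2 * k) \<or>
               card (fixed_vectors g) = q ^ (2 * k + 1)}
         = w_AC k (a / real q) (1 / real q ^ 2)"
proof -
  have "pair_prob a TYPE('a) k = w_AC k (a / real q) (1 / real q ^ 2)"
    using pair_prob_wt[OF a, of k, where 'a = 'a] pair_prob_0[OF a, where 'a = 'a]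
    by (simp only: q w_AC_def wt_def)
  then show ?thesis by (simp add: pair_prob_def q)
qed

end
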